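(* Assume that the noise terms $\xi_i$ are subgaussian with parameter $\sigma>0$, i.e. $\mathbb E[e^{u\xi_i}]\le e^{u^2\sigma^2/2}$ for all $u\in\mathbb R$. For any positive number $q$ there exists a positive constant $A'_q$ (depending only on $q$, $d$ and $\sigma$) such that, for every integer $n\ge 2$ for which $r=\left\lfloor\left(\frac{n}{\ln n}\right)^{\frac{d-1}{d+1}}\right\rfloor$ satisfies $r\ge d+1$, the estimator $\hat P_n^{(r)}$ with this value of $r$ satisfies $$\sup_{C\in\mathcal C_d} \mathbb E_C\Big[|\hat P_n^{(r)}\triangle C|^q\Big]\leq A'_q\left(\frac{\ln n}{n}\right)^{\frac{2q}{d+1}}.$$
   Context: Let $d\ge 2$ be an integer. One observes $n$ i.i.d. pairs $(X_i,Y_i)$, $i=1,\dots,n$, with $X_i$ uniformly distributed on $[0,1]^d$ and $Y_i=I(X_i\in G)+\xi_i$, where $G\subseteq[0,1]^d$ is unknown, $I(\cdot\in G)$ is the indicator function of $G$, and the errors $\xi_1,\dots,\xi_n$ are i.i.d. real random variables independent of $(X_1,\dots,X_n)$. $\mathbb E_G$ denotes expectation with respect to the distribution of the $n$ pairs. $|\cdot|$ is Lebesgue measure on $\mathbb R^d$, $\triangle$ is symmetric difference, and $\lfloor x\rfloor$ is the greatest integer less than or equal to $x$. All convex sets considered are compact with nonempty interior. $\mathcal C_d$ is the class of all (compact) convex sets included in $[0,1]^d$. For $r\ge d+1$, $\mathcal P_r^{(n)}$ is the (finite) class of all convex polytopes in $[0,1]^d$ with at most $r$ vertices whose vertices have coordinates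 that are integer multiples of $1/n$. Put $\mathcal A(P)=\sum_{i=1}^n(1-2Y_i)I(X_i\in P)$. The estimator $\hat P_n^{(r)}$ is any (measurable) choice of an element of $\operatorname{argmin}_{P\in\mathcal P_r^{(n)}}\mathcal A(P)$. *)

theory Defs
  imports "HOL-Probability.Probability"
begin

(* The unit cube [0,1]^d of R^d, with d = CARD('d). *)
definition unit_cube :: "(real ^ 'd) set" where
  "unit_cube = {x. \<forall>i. 0 \<le> x $ i \<and> x $ i \<le> 1}"

definition convex_bodies :: "(real ^ 'd) set set" where
  "convex_bodies = {C. convex C \<and> compact C \<and> interior C \<noteq> {} \<and> C \<subseteq> unit_cube}"

(* Vertices are the extreme points; a polytope has finitely many, so card is not degenerate here. *)
definition grid_polytopes :: "nat \<Rightarrow> nat \<Rightarrow> (real ^ 'd) set set" where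
  "grid_polytopes n r = {P. polytope P \<and> interior P \<noteq> {} \<and> P \<subseteq> unit_cube \<and>
     card {v. v extreme_point_of P} \<le> r \<and>
     (\<forall>v. v extreme_point_of P \<longrightarrow> (\<forall>i. \<exists>k::int. v $ i = of_int k / of_nat n))}"

(* E[exp(u xi)] is taken in [0,\<infinity>], so the bound includes finiteness of the expectation. *)
definition subgaussian :: "real \<Rightarrow> real measure \<Rightarrow> bool" where
  "subgaussian \<sigma> \<mu> \<longleftrightarrow>
     (\<forall>u::real. (\<integral>\<^sup>+ x. ennreal (exp (u * x)) \<partial>\<mu>) \<le> ennreal (exp (u\<^sup>2 * \<sigma>\<^sup>2 / 2)))"

(* Law of one pair (X, I(X in G) + xi), where X is uniform on the cube and xi has law \<mu>;
   the product measure expresses the independence of X and xi. *)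
definition pair_law :: "real measure \<Rightarrow> (real ^ 'd) set \<Rightarrow> ((real ^ 'd) \<times> real) measure" where
  "pair_law \<mu> G = distr (uniform_measure lborel unit_cube \<Otimes>\<^sub>M \<mu>) borel
     (\<lambda>(x, \<xi>). (x, indicator G x + \<xi>))"

(* Joint law of n i.i.d. pairs; a sample is a function on the index set {1..n}. *)
definition sample_law ::
    "real measure \<Rightarrow> nat \<Rightarrow> (real ^ 'd) set \<Rightarrow> (nat \<Rightarrow> (real ^ 'd) \<times> real) measure" where
  "sample_law \<mu> n G = PiM {1..n} (\<lambda>i. pair_law \<mu> G)"

definition contrast :: "nat \<Rightarrow> (nat \<Rightarrow> (real ^ 'd) \<times> real) \<Rightarrow> (real ^ 'd) set \<Rightarrow> real" where
  "contrast n z P = (\<Sum>i = 1..n. (1 - 2 * snd (z i)) * indicator P (fst (z i)))"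

(* An estimator is a statistic, i.e. a measurable function of the sample. Its range is a finite
   class of polytopes, which carries the discrete sigma-algebra. *)
definition polytope_estimator ::
    "nat \<Rightarrow> nat \<Rightarrow> ((nat \<Rightarrow> (real ^ 'd) \<times> real) \<Rightarrow> (real ^ 'd) set) \<Rightarrow> bool" where
  "polytope_estimator n r Phat \<longleftrightarrow>
     Phat \<in> PiM {1..n} (\<lambda>i. borel) \<rightarrow>\<^sub>M count_space (grid_polytopes n r) \<and>
     (\<forall>z \<in> space (PiM {1..n} (\<lambda>i. borel)).
        is_arg_min (contrast n z) (\<lambda>P. P \<in> grid_polytopes n r) (Phat z))"

end

theory Submission
  imports Defs
begin

text \<open>
  Approximation: project a net of mesh of order \<open>1 / m\<close> on the boundary of a larger cube onto the
  convex body. By convexity the support function of the hull of the projected points falls short of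
  that of the body by only \<open>O(1 / m\<^sup>2)\<close>, so \<open>O(m ^ (d - 1))\<close> vertices suffice; rounding them to the grid
  and adding a tiny grid simplex (for nonempty interior) costs a further \<open>O(1 / n)\<close> in Hausdorff
  distance. For convex subsets of the cube, Hausdorff distance controls volume: a band of width
  \<open>\<epsilon>\<close> swept along an axis has about \<open>1 / \<epsilon>\<close> disjoint translates in a bounded region.

  Deviation: for a fixed good polytope \<open>Q\<close>, the exponential moment of the contrast difference of \<open>P\<close>
  and \<open>Q\<close> is at most \<open>exp (n (b |Q \<triangle> C| - a |P \<triangle> C|))\<close>. A union bound over the grid polytopes, of
  which there are at most \<open>(n + 1) ^ (d r)\<close>, then bounds the risk.
\<close>

section \<open>Polytopes from projected nets\<close>

text \<open>If \<open>w \<bullet> u\<close> is maximal over \<open>C\<close> at \<open>x\<close>,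
  then \<open>u\<close> is an outer normal there. In the expansion of the squared distance from
  \<open>x + t *\<^sub>R u\<close> to a point \<open>w\<close> of \<open>C\<close> the cross term is
  therefore nonnegative, so \<open>x\<close> is nearest.\<close>

lemma closest_point_self_ray:
  fixes C :: "'a::euclidean_space set"
  assumes "convex C" "closed C" "x \<in> C" "\<And>w. w \<in> C \<Longrightarrow> w \<bullet> u \<le> x \<bullet> u" "0 \<le> t"
  shows "closest_point C (x + t *\<^sub>R u) = x"
proof -
  have "norm (t *\<^sub>R u) \<le> norm (x + t *\<^sub>R u - w)" if "w \<in> C" for w
  proof -
    have "(x - w) \<bullet> (t *\<^sub>R u) \<ge> 0"
      using assms(4)[OF that] assms(5) by (simp add: inner_diff_left)
    moreover have "0 \<le> (x - w) \<bullet> (x - w)" by simp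
    ultimately have "(t *\<^sub>R u) \<bullet> (t *\<^sub>R u) \<le> ((x - w) + t *\<^sub>R u) \<bullet> ((x - w) + t *\<^sub>R u)"
      unfolding inner_add_left inner_add_right inner_commute[of "t *\<^sub>R u" "x - w"] by linarith
    then have "norm (t *\<^sub>R u) \<le> norm ((x - w) + t *\<^sub>R u)" unfolding norm_le .
    then show ?thesis by (simp only: add.commute diff_add_eq add_diff_eq)
  qed
  then show ?thesis
    using closest_point_unique[OF assms(1-3), of "x + t *\<^sub>R u"]
    by (simp add: dist_norm)
qed

text \<open>Closeness of the base points makes the support gap quadratically small, because the
  displacement of the projections is paired with the displacement of the normal vectors.\<close>
lemma closest_point_support_gap:
  fixes C :: "'a::euclidean_space set"
  assumes "convex C" "closed C" "C \<noteq> {}"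
  shows "(closest_point C y - closest_point C z) \<bullet> (y - closest_point C y) \<le> (norm (y - z))\<^sup>2"
proof -
  define p where "p = closest_point C y - closest_point C z"
  define w where "w = y - z"
  have "p \<bullet> (z - closest_point C z) \<le> 0"
    using closest_point_dot[OF assms(1,2) closest_point_in_set[OF assms(2,3)], of z y]
    by (simp add: p_def inner_commute)
  moreover have "p \<bullet> (y - closest_point C y) = p \<bullet> (z - closest_point C z) + p \<bullet> (w - p)"
    by (simp add: p_def w_def algebra_simps)
  \<comment> \<open>Completing the square bounds \<open>p \<bullet> (w - p)\<close> by a quarter of
    the square of \<open>norm w\<close>.\<close>
  moreover have "0 \<le> (norm (p - (1/2) *\<^sub>R w))\<^sup>2" by simp
  then have "p \<bullet> (w - p) \<le> (w \<bullet> w) / 4"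
    unfolding power2_norm_eq_inner by (simp add: algebra_simps inner_commute)
  moreover have "0 \<le> w \<bullet> w" by simp
  ultimately show ?thesis
    unfolding p_def[symmetric] w_def[symmetric] power2_norm_eq_inner by linarith
qed

text \<open>Let \<open>u\<close> point from the hull point \<open>p\<close> nearest to
  \<open>y\<close> towards \<open>y\<close>. The maximiser \<open>x\<close> of
  \<open>w \<bullet> u\<close> over \<open>C\<close> is the projection of its whole outward ray, and
  a net point near that ray projects to a point of the hull. By the quadratic support gap,
  \<open>C\<close> exceeds the hull in direction \<open>u\<close> by at most the square of
  \<delta>.\<close>

lemma near_hull_of_projected_net:
  fixes C :: "'a::euclidean_space set"
  assumes C: "convex C" "compact C" "C \<noteq> {}" and Z: "finite Z" "Z \<noteq> {}"
    and net: "\<And>x u. \<lbrakk>x \<in> C; norm u = 1\<rbrakk> \<Longrightarrow> \<exists>t\<ge>1. \<exists>z\<in>Z. norm (x + t *\<^sub>R u - z) \<le> \<delta>"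
    and y: "y \<in> C"
  shows "\<exists>p \<in> convex hull (closest_point C ` Z). dist y p \<le> \<delta>\<^sup>2"
proof -
  let ?P = "convex hull (closest_point C ` Z)"
  have closed: "closed C" using C by (simp add: compact_imp_closed)
  have P: "convex ?P" "closed ?P" "?P \<noteq> {}"
    using Z by (auto simp: finite_imp_compact_convex_hull compact_imp_closed)
  define p where "p = closest_point ?P y"
  have p: "p \<in> ?P" unfolding p_def by (rule closest_point_in_set[OF P(2,3)])
  show ?thesis
  proof (cases "y = p")
    case True
    then show ?thesis using p by (intro bexI[of _ p]) auto
  next
    case False
    define u where "u = (y - p) /\<^sub>R norm (y - p)"
    have u1: "norm u = 1" using False by (simp add: u_def)
    obtain x where x: "x \<in> C" "\<And>w. w \<in> C \<Longrightarrow> w \<bullet> u \<le> x \<bullet> u"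
      using continuous_attains_sup[OF C(2,3), of "\<lambda>w. w \<bullet> u"] by (fastforce intro!: continuous_intros)
    obtain t z where tz: "t \<ge> 1" "z \<in> Z" "norm (x + t *\<^sub>R u - z) \<le> \<delta>"
      using net[OF x(1) u1] by auto
    define x' where "x' = closest_point C z"
    have cp: "closest_point C (x + t *\<^sub>R u) = x"
      using tz by (intro closest_point_self_ray[OF C(1) closed x]) auto
    have "(x - x') \<bullet> (t *\<^sub>R u) \<le> (norm (x + t *\<^sub>R u - z))\<^sup>2"
      using closest_point_support_gap[OF C(1) closed C(3), of "x + t *\<^sub>R u" z]
      by (simp add: cp x'_def)
    also have "\<dots> \<le> \<delta>\<^sup>2" using tz(3) by (simp add: power_mono)
    finally have "t * ((x - x') \<bullet> u) \<le> \<delta>\<^sup>2" by simp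
    moreover have "x' \<in> C" unfolding x'_def using closest_point_in_set[OF closed C(3)] .
    then have "0 \<le> (x - x') \<bullet> u" using x(2) by (simp add: inner_diff_left)
    then have "(x - x') \<bullet> u \<le> t * ((x - x') \<bullet> u)" using tz(1) by (simp add: mult_le_cancel_right1)
    \<comment> \<open>The hull, hence \<open>x'\<close>, lies behind the hyperplane through
      \<open>p\<close> with normal \<open>u\<close>.\<close>
    moreover have "(y - p) \<bullet> (x' - p) \<le> 0"
      unfolding p_def by (rule closest_point_dot[OF P(1,2)]) (auto simp: x'_def tz(2) hull_inc)
    then have "(x' - p) \<bullet> u \<le> 0"
      unfolding u_def by (simp add: inner_commute mult_le_0_iff)
    moreover have "y \<bullet> u \<le> x \<bullet> u" using x(2) y .
    ultimately have "(y - p) \<bullet> u \<le> \<delta>\<^sup>2" by (simp add: inner_diff_left)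
    moreover have "(y - p) \<bullet> u = norm (y - p)"
      unfolding u_def using False by (simp add: dot_square_norm power2_eq_square)
    ultimately show ?thesis using p by (auto simp: dist_norm)
  qed
qed

section \<open>A net on the boundary of the cube with coordinates between -2 and 2\<close>

lemma exists_grid_approx:
  fixes a :: real
  assumes "\<bar>a\<bar> \<le> 2" "m \<ge> (1::nat)"
  shows "\<exists>k \<in> {- int m..int m}. \<bar>a - 2 * of_int k / of_nat m\<bar> \<le> 2 / of_nat m"
proof -
  define k where "k = \<lfloor>a * m / 2\<rfloor>"
  have "a * real m \<le> 2 * real m" "(- 2) * real m \<le> a * real m"
    using mult_right_mono[of a 2 "real m"] mult_right_mono[of "- 2" a "real m"] assms(1) by auto
  then have "k \<in> {- int m..int m}"
    unfolding k_def by (auto simp: le_floor_iff floor_le_iff)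
  moreover have "\<bar>a - 2 * of_int k / of_nat m\<bar> \<le> 2 / of_nat m"
  proof -
    have "0 \<le> a * m / 2 - of_int k" "a * m / 2 - of_int k \<le> 1" unfolding k_def by linarith+
    moreover have "a - 2 * of_int k / of_nat m = (2 / m) * (a * m / 2 - of_int k)"
      using assms by (simp add: field_simps)
    ultimately show ?thesis using assms by (simp add: abs_mult divide_right_mono)
  qed
  ultimately show ?thesis by blast
qed

text \<open>The intermediate value theorem for the maximum norm along the ray gives the exit point.
  One coordinate has to grow in absolute value from at most 1 to 2 at speed at most 1, which forces
  \<open>t \<ge> 1\<close>.\<close>

lemma exit_through_cube_boundary:
  fixes x u :: "'a::euclidean_space"
  assumes x: "x \<in> cbox 0 One" and u: "norm u = 1"
  obtains t b where "t \<ge> 1" "b \<in> Basis" "\<bar>(x + t *\<^sub>R u) \<bullet> b\<bar> = 2"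
    "\<And>c. c \<in> Basis \<Longrightarrow> \<bar>(x + t *\<^sub>R u) \<bullet> c\<bar> \<le> 2"
proof -
  define f where "f t = infnorm (x + t *\<^sub>R u)" for t
  have x1: "\<bar>x \<bullet> c\<bar> \<le> 1" if "c \<in> Basis" for c
    using x that by (auto simp: mem_box)
  have "f 0 \<le> 2"
    using x1 by (force simp: f_def infnorm_Max)
  moreover have "\<exists>T\<ge>0. f T \<ge> 2"
  proof -
    have "infnorm u > 0" using u by (auto simp: infnorm_pos_lt)
    \<comment> \<open>The displacement then has maximum norm 3, of which \<open>x\<close> can cancel
      at most 1.\<close>
    define T where "T = 3 / infnorm u"
    have "infnorm (T *\<^sub>R u) = 3"
      using \<open>infnorm u > 0\<close> by (simp add: T_def infnorm_mul)
    moreover have "infnorm x \<le> 1" using x1 by (force simp: infnorm_Max)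
    moreover have "infnorm (T *\<^sub>R u) \<le> infnorm (x + T *\<^sub>R u) + infnorm x"
      using infnorm_triangle[of "x + T *\<^sub>R u" "- x"] by (simp add: infnorm_neg)
    ultimately show ?thesis using \<open>infnorm u > 0\<close> by (intro exI[of _ T]) (auto simp: f_def T_def)
  qed
  then obtain T where "T \<ge> 0" "f T \<ge> 2" by auto
  moreover have "continuous_on {0..T} f"
    unfolding f_def by (intro continuous_intros)
  ultimately obtain t where t: "0 \<le> t" "f t = 2"
    using IVT'[of f 0 2 T] by auto
  have fin: "finite ((\<lambda>i. \<bar>(x + t *\<^sub>R u) \<bullet> i\<bar>) ` Basis)" "(\<lambda>i. \<bar>(x + t *\<^sub>R u) \<bullet> i\<bar>) ` Basis \<noteq> {}"
    by auto
  obtain b where b: "b \<in> Basis" "\<bar>(x + t *\<^sub>R u) \<bullet> b\<bar> = 2"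
    using Max_in[OF fin] t(2) unfolding f_def infnorm_Max by auto
  have le: "\<bar>(x + t *\<^sub>R u) \<bullet> c\<bar> \<le> 2" if "c \<in> Basis" for c
    using Max_ge[OF fin(1), of "\<bar>(x + t *\<^sub>R u) \<bullet> c\<bar>"] t(2) that unfolding f_def infnorm_Max by auto
  have "t \<ge> 1"
  proof -
    have "2 \<le> \<bar>x \<bullet> b\<bar> + t * \<bar>u \<bullet> b\<bar>"
      using b(2) t(1) abs_triangle_ineq[of "x \<bullet> b" "t * (u \<bullet> b)"]
      by (simp add: inner_add_left abs_mult)
    moreover have "\<bar>u \<bullet> b\<bar> \<le> 1" using Basis_le_norm[OF b(1), of u] u by simp
    then have "t * \<bar>u \<bullet> b\<bar> \<le> t" using t(1) by (simp add: mult_left_le)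
    ultimately show ?thesis using x1[OF b(1)] by linarith
  qed
  then show ?thesis using that b le by blast
qed

text \<open>Each of the \<open>2 * DIM('a)\<close> faces carries a grid of mesh
  \<open>2 / m\<close>: one coordinate is fixed at 2 or -2, and each of the others takes one of
  \<open>2 * m + 1\<close> values.\<close>

lemma cube_boundary_net:
  assumes m: "m \<ge> (1::nat)"
  obtains Z :: "'a::euclidean_space set" where "finite Z" "Z \<noteq> {}"
    "card Z \<le> 2 * DIM('a) * (2 * m + 1) ^ (DIM('a) - 1)"
    "\<And>x u. \<lbrakk>x \<in> cbox 0 One; norm u = 1\<rbrakk> \<Longrightarrow>
       \<exists>t\<ge>1. \<exists>z\<in>Z. norm (x + t *\<^sub>R u - z) \<le> 2 * DIM('a) / m"
proof -
  define G where "G = (\<lambda>k. 2 * of_int k / real m) ` {- int m..int m}"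
  have cardG: "card G = 2 * m + 1"
    unfolding G_def using m by (subst card_image) (auto simp: inj_on_def)
  have finG: "finite G" by (simp add: G_def)
  define pt where "pt b s f = s *\<^sub>R b + (\<Sum>c\<in>Basis - {b}. f c *\<^sub>R c)"
    for b :: 'a and s :: real and f :: "'a \<Rightarrow> real"
  define Z1 where "Z1 b = (\<lambda>(s, f). pt b s f) ` ({2, -2} \<times> (Basis - {b} \<rightarrow>\<^sub>E G))" for b
  define Z where "Z = (\<Union>b\<in>Basis. Z1 b)"
  have finZ1: "finite (Z1 b)" for b
    unfolding Z1_def using finG by (intro finite_imageI finite_cartesian_product finite_PiE) auto
  have cardZ1: "card (Z1 b) \<le> 2 * (2 * m + 1) ^ (DIM('a) - 1)" if "b \<in> Basis" for b
  proof -
    have "card (Z1 b) \<le> card ({2::real, -2} \<times> (Basis - {b} \<rightarrow>\<^sub>E G))"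
      unfolding Z1_def using finG by (intro card_image_le finite_cartesian_product finite_PiE) auto
    also have "\<dots> = 2 * (2 * m + 1) ^ (DIM('a) - 1)"
      using that by (simp add: card_cartesian_product card_PiE cardG)
    finally show ?thesis .
  qed
  have cardZ: "card Z \<le> 2 * DIM('a) * (2 * m + 1) ^ (DIM('a) - 1)"
  proof -
    have "card Z \<le> (\<Sum>b\<in>Basis. card (Z1 b))"
      unfolding Z_def by (rule card_UN_le) simp
    also have "\<dots> \<le> (\<Sum>b\<in>(Basis::'a set). 2 * (2 * m + 1) ^ (DIM('a) - 1))"
      by (intro sum_mono cardZ1)
    finally show ?thesis by (simp add: algebra_simps)
  qed
  have approx: "\<exists>t\<ge>1. \<exists>z\<in>Z. norm (x + t *\<^sub>R u - z) \<le> 2 * DIM('a) / m"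
    if xu: "x \<in> cbox 0 One" "norm u = 1" for x u :: 'a
  proof -
    obtain t b where t: "t \<ge> 1" and b: "b \<in> Basis" "\<bar>(x + t *\<^sub>R u) \<bullet> b\<bar> = 2"
      and le: "\<And>c. c \<in> Basis \<Longrightarrow> \<bar>(x + t *\<^sub>R u) \<bullet> c\<bar> \<le> 2"
      using exit_through_cube_boundary[OF xu] by blast
    define y where "y = x + t *\<^sub>R u"
    have "\<exists>g\<in>G. \<bar>y \<bullet> c - g\<bar> \<le> 2 / m" if "c \<in> Basis" for c
      using exists_grid_approx[OF le[OF that] m] unfolding G_def y_def by auto
    then obtain g where g: "\<And>c. c \<in> Basis \<Longrightarrow> g c \<in> G \<and> \<bar>y \<bullet> c - g c\<bar> \<le> 2 / m"
      by metis
    \<comment> \<open>The coordinate that reaches the face is kept exactly, and only the others are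
      rounded, so the net point lies on the same face as \<open>y\<close>.\<close>
    define f where "f = restrict g (Basis - {b})"
    define z where "z = pt b (y \<bullet> b) f"
    have "z \<in> Z1 b"
      unfolding Z1_def z_def using b(2) g
      by (auto simp: f_def y_def abs_if split: if_splits intro!: image_eqI[where x = "(y \<bullet> b, f)"])
    then have "z \<in> Z" using b(1) by (auto simp: Z_def)
    moreover have "\<bar>(y - z) \<bullet> c\<bar> \<le> 2 / m" if "c \<in> Basis" for c
    proof -
      have *: "(\<Sum>e\<in>Basis - {b}. f e *\<^sub>R e) \<bullet> c = (if c = b then 0 else f c)"
        using that by (simp add: inner_sum_left inner_Basis if_distrib sum.delta cong: if_cong)
      have "z \<bullet> c = (if c = b then y \<bullet> b else g c)"
        using b(1) that unfolding z_def pt_def inner_add_left * by (simp add: inner_Basis f_def)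
      then show ?thesis using g[OF that] by (auto simp: inner_diff_left)
    qed
    then have "norm (y - z) \<le> (\<Sum>c\<in>(Basis::'a set). 2 / m)"
      by (intro order_trans[OF norm_le_l1] sum_mono)
    ultimately show ?thesis
      using t by (intro exI[of _ t] conjI bexI[of _ z]) (auto simp: y_def mult.commute)
  qed
  have "Z \<noteq> {}"
  proof -
    obtain b where "b \<in> (Basis :: 'a set)" using nonempty_Basis by blast
    moreover have "0 \<in> G" unfolding G_def by (rule image_eqI[of _ _ 0]) auto
    then have "restrict (\<lambda>_. 0) (Basis - {b}) \<in> (Basis - {b} \<rightarrow>\<^sub>E G)" by auto
    ultimately show ?thesis unfolding Z_def Z1_def by blast
  qed
  moreover have "finite Z" unfolding Z_def using finZ1 by auto
  ultimately show ?thesis using that cardZ approx by blast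
qed

section \<open>Volume of thin bands around convex sets\<close>

text \<open>For \<epsilon> \<ge> 0 this is the Minkowski sum of \<open>A\<close> and the segment
  from 0 to \<open>\<epsilon> *\<^sub>R e\<close>.\<close>

definition sweep :: "real \<Rightarrow> 'a \<Rightarrow> 'a::euclidean_space set \<Rightarrow> 'a set" where
  "sweep \<epsilon> e A = (\<lambda>(a, s). a + s *\<^sub>R e) ` (A \<times> {0..\<epsilon>})"

lemma compact_sweep: "compact A \<Longrightarrow> compact (sweep \<epsilon> e A)"
  unfolding sweep_def
  by (intro compact_continuous_image compact_Times) (auto simp: case_prod_unfold intro!: continuous_intros)

lemma convex_sweep: "convex A \<Longrightarrow> convex (sweep \<epsilon> e A)"
  unfolding sweep_def
  by (intro convex_linear_image convex_Times)
    (auto simp: linear_iff case_prod_unfold algebra_simps)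

lemma sweep_subset_cball:
  assumes "A \<subseteq> cball 0 L" "norm e \<le> 1"
  shows "sweep \<epsilon> e A \<subseteq> cball 0 (L + \<epsilon>)"
proof -
  have "norm (a + s *\<^sub>R e) \<le> L + \<epsilon>" if "a \<in> A" "0 \<le> s" "s \<le> \<epsilon>" for a s
  proof -
    have "norm a \<le> L" using that(1) assms(1) by auto
    moreover have "s * norm e \<le> s" using that(2) assms(2) by (simp add: mult_left_le)
    ultimately show ?thesis using norm_triangle_ineq[of a "s *\<^sub>R e"] that by simp
  qed
  then show ?thesis by (auto simp: sweep_def)
qed

text \<open>The swept band lies past the exit point of each line parallel to \<open>e\<close>, within distance
  \<open>\<epsilon>\<close>; hence its translates by multiples of \<open>\<epsilon> e\<close> are pairwise disjoint, and about
  \<open>1 / \<epsilon>\<close> of them fit into a ball of fixed radius.\<close>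
lemma sweep_band_disjoint:
  assumes "convex A" and w: "w \<in> sweep \<epsilon> e A" "w \<notin> A" and wt: "w + t *\<^sub>R e \<in> sweep \<epsilon> e A" and "t \<ge> \<epsilon>"
  shows False
proof -
  obtain a' s' where a': "a' \<in> A" "0 \<le> s'" "s' \<le> \<epsilon>" "w = a' + s' *\<^sub>R e"
    using w by (auto simp: sweep_def)
  obtain a s where a: "a \<in> A" "0 \<le> s" "s \<le> \<epsilon>" "w + t *\<^sub>R e = a + s *\<^sub>R e"
    using wt by (auto simp: sweep_def)
  have s': "s' > 0" using a' w(2) by (cases "s' = 0") auto
  \<comment> \<open>The point \<open>w\<close> is on the segment from \<open>a'\<close>, which is
    \<open>s'\<close> behind it, to \<open>a\<close>, which is \<open>r\<close> ahead of it;
    convexity puts \<open>w\<close> into \<open>A\<close>.\<close>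
  define r where "r = t - s"
  have r: "r \<ge> 0" using a assms(5) by (simp add: r_def)
  have wa: "w + r *\<^sub>R e = a" using a(4) by (simp add: r_def algebra_simps)
  have sum1: "r / (r + s') + s' / (r + s') = 1" using r s' by (simp flip: add_divide_distrib)
  have "(r / (r + s')) *\<^sub>R a' + (s' / (r + s')) *\<^sub>R a \<in> A"
    using r s' by (intro convexD[OF assms(1) a'(1) a(1) _ _ sum1]) auto
  also have "(r / (r + s')) *\<^sub>R a' + (s' / (r + s')) *\<^sub>R a
      = (r / (r + s') + s' / (r + s')) *\<^sub>R w + ((s' / (r + s')) * r - (r / (r + s')) * s') *\<^sub>R e"
    unfolding wa[symmetric] using a'(4) by (simp add: algebra_simps)
  also have "\<dots> = w" using sum1 by (simp add: mult.commute)
  finally show False using w(2) by simp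
qed

lemma measure_sweep_band:
  fixes A :: "'a::euclidean_space set"
  assumes A: "convex A" "compact A" "A \<subseteq> cball 0 L" and e: "norm e \<le> 1" and \<epsilon>: "0 < \<epsilon>" "\<epsilon> \<le> 1"
  shows "measure lebesgue (sweep \<epsilon> e A - A) \<le> \<epsilon> * measure lebesgue (cball (0::'a) (L + 2))"
proof -
  define D where "D = sweep \<epsilon> e A - A"
  \<comment> \<open>The \<open>N + 1\<close> translates are shifted by at most
    \<open>N * \<epsilon> \<le> 1\<close>, so they fit into the ball of radius \<open>L + 2\<close>,
    and \<open>(N + 1) * \<epsilon> \<ge> 1\<close> converts their number into the factor
    \<epsilon>.\<close>
  define N where "N = nat \<lfloor>1 / \<epsilon>\<rfloor>"
  define T where "T k = (+) ((real k * \<epsilon>) *\<^sub>R e) ` D" for k :: nat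
  have N: "real N * \<epsilon> \<le> 1" "1 \<le> (real N + 1) * \<epsilon>"
  proof -
    have "real N = of_int \<lfloor>1 / \<epsilon>\<rfloor>" using \<epsilon> by (simp add: N_def)
    then have "real N \<le> 1 / \<epsilon>" "1 / \<epsilon> \<le> real N + 1" by linarith+
    then show "real N * \<epsilon> \<le> 1" "1 \<le> (real N + 1) * \<epsilon>" using \<epsilon> by (simp_all add: field_simps)
  qed
  have D: "D \<in> lmeasurable"
    unfolding D_def by (intro fmeasurable.Diff lmeasurable_compact compact_sweep A)
  have T: "T k \<in> lmeasurable" for k
    unfolding T_def by (rule measurable_translation[OF D])
  have "disjoint_family_on T {..N}"
  proof -
    have False if "i < j" "y \<in> T i" "y \<in> T j" for i j y
    proof -
      obtain v w where vw: "v \<in> D" "y = (real i * \<epsilon>) *\<^sub>R e + v" "w \<in> D" "y = (real j * \<epsilon>) *\<^sub>R e + w"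
        using \<open>y \<in> T i\<close> \<open>y \<in> T j\<close> unfolding T_def by blast
      then have "v = w + ((real j - real i) * \<epsilon>) *\<^sub>R e"
        by (simp add: algebra_simps)
      moreover have "\<epsilon> \<le> (real j - real i) * \<epsilon>"
        using \<epsilon> \<open>i < j\<close> by simp
      ultimately show False
        using sweep_band_disjoint[OF A(1), of w \<epsilon> e "(real j - real i) * \<epsilon>"] vw by (auto simp: D_def)
    qed
    then show ?thesis
      unfolding disjoint_family_on_def by (metis disjoint_iff linorder_neqE_nat)
  qed
  then have "measure lebesgue (\<Union>k\<in>{..N}. T k) = (\<Sum>k\<le>N. measure lebesgue (T k))"
    using fmeasurableD[OF T] fmeasurableD2[OF T] by (intro measure_finite_Union) (auto simp del: emeasure_completion)
  also have "\<dots> = (real N + 1) * measure lebesgue D"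
    by (simp add: T_def measure_translation)
  finally have "(real N + 1) * measure lebesgue D = measure lebesgue (\<Union>k\<in>{..N}. T k)" ..
  also have "\<dots> \<le> measure lebesgue (cball (0::'a) (L + 2))"
  proof (rule measure_mono_fmeasurable)
    have "D \<subseteq> cball 0 (L + 1)"
      using sweep_subset_cball[OF A(3) e, of \<epsilon>] \<epsilon> by (force simp: D_def)
    moreover have "norm ((real k * \<epsilon>) *\<^sub>R e) \<le> 1" if "k \<le> N" for k
    proof -
      have "real k * \<epsilon> \<le> real N * \<epsilon>" using that \<epsilon> by simp
      then have "real k * \<epsilon> \<le> 1" using N by linarith
      then show ?thesis using e \<epsilon> by (simp add: mult_le_one)
    qed
    ultimately show "(\<Union>k\<in>{..N}. T k) \<subseteq> cball 0 (L + 2)"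
    proof -
      assume 1: "D \<subseteq> cball 0 (L + 1)" and 2: "\<And>k. k \<le> N \<Longrightarrow> norm ((real k * \<epsilon>) *\<^sub>R e) \<le> 1"
      have "norm ((real k * \<epsilon>) *\<^sub>R e + x) \<le> L + 2" if "k \<le> N" "x \<in> D" for k x
      proof -
        have "norm x \<le> L + 1" using 1 that by auto
        then show ?thesis using 2[OF that(1)] norm_triangle_ineq[of "(real k * \<epsilon>) *\<^sub>R e" x] by linarith
      qed
      then show ?thesis by (auto simp: T_def)
    qed
  qed (use T in \<open>auto intro!: sets.finite_UN\<close>)
  finally have le: "(real N + 1) * measure lebesgue D \<le> measure lebesgue (cball (0::'a) (L + 2))" .
  have "1 * measure lebesgue D \<le> ((real N + 1) * \<epsilon>) * measure lebesgue D"
    using N by (intro mult_right_mono) auto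
  also have "\<dots> = \<epsilon> * ((real N + 1) * measure lebesgue D)" by simp
  also have "\<dots> \<le> \<epsilon> * measure lebesgue (cball (0::'a) (L + 2))"
    using le \<epsilon> by (intro mult_left_mono) auto
  finally show ?thesis by (simp add: D_def)
qed

text \<open>Sweeping forwards and then backwards along each axis in turn preserves convexity, so the
  band estimate applies again at every stage. Each of the two sweeps per axis adds volume of order
  \<epsilon>.\<close>

lemma thicken_along_axes:
  fixes A :: "'a::euclidean_space set"
  assumes A: "convex A" "compact A" "A \<subseteq> cball 0 L" and \<epsilon>: "0 < \<epsilon>" "\<epsilon> \<le> 1"
    and "finite S" "S \<subseteq> Basis"
  shows "\<exists>T. convex T \<and> compact T \<and> T \<subseteq> cball 0 (L + 2 * real (card S)) \<and>
    measure lebesgue (T - A) \<le> 2 * real (card S) * \<epsilon> * measure lebesgue (cball (0::'a) (L + 2 * real DIM('a) + 2)) \<and>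
    (\<forall>a\<in>A. \<forall>c. (\<forall>b\<in>S. \<bar>c b\<bar> \<le> \<epsilon>) \<longrightarrow> a + (\<Sum>b\<in>S. c b *\<^sub>R b) \<in> T)"
  using assms(6,7)
proof (induction S rule: finite_induct)
  case empty
  show ?case using A by (intro exI[of _ A]) auto
next
  case (insert b S)
  \<comment> \<open>A single ball, large enough for all intermediate sets and their translates,
    gives every sweep the same constant.\<close>
  define V where "V = measure lebesgue (cball (0::'a) (L + 2 * real DIM('a) + 2))"
  obtain T where T: "convex T" "compact T" "T \<subseteq> cball 0 (L + 2 * real (card S))"
    "measure lebesgue (T - A) \<le> 2 * real (card S) * \<epsilon> * V"
    "\<And>a c. a \<in> A \<Longrightarrow> (\<forall>b\<in>S. \<bar>c b\<bar> \<le> \<epsilon>) \<Longrightarrow> a + (\<Sum>b\<in>S. c b *\<^sub>R b) \<in> T"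
    using insert unfolding V_def by auto
  have b: "norm b \<le> 1" "norm (- b) \<le> 1" using insert.prems by auto
  define T1 where "T1 = sweep \<epsilon> b T"
  define T2 where "T2 = sweep \<epsilon> (- b) T1"
  have T1: "convex T1" "compact T1" "T1 \<subseteq> cball 0 (L + 2 * real (card S) + \<epsilon>)"
    unfolding T1_def using convex_sweep[OF T(1)] compact_sweep[OF T(2)] sweep_subset_cball[OF T(3) b(1)] by auto
  have T2: "convex T2" "compact T2" "T2 \<subseteq> cball 0 (L + 2 * real (card S) + \<epsilon> + \<epsilon>)"
    unfolding T2_def using convex_sweep[OF T1(1)] compact_sweep[OF T1(2)] sweep_subset_cball[OF T1(3) b(2)] by blast+
  have card: "card (insert b S) = Suc (card S)" using insert by simp
  have cardD: "Suc (card S) \<le> DIM('a)"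
    using card_mono[OF finite_Basis insert.prems] card by simp
  have V: "measure lebesgue (cball (0::'a) (R + 2)) \<le> V" if "R \<le> L + 2 * real DIM('a)" for R
    unfolding V_def using that by (intro measure_mono_fmeasurable) auto
  have lm: "X - Y \<in> lmeasurable" if "compact X" "compact Y" for X Y :: "'a set"
    using that by (intro fmeasurable.Diff lmeasurable_compact)
  have m1: "measure lebesgue (T1 - T) \<le> \<epsilon> * V"
    unfolding T1_def
    using order_trans[OF measure_sweep_band[OF T(1-3) b(1) \<epsilon>] mult_left_mono[OF V]] \<epsilon> cardD by simp
  have m2: "measure lebesgue (T2 - T1) \<le> \<epsilon> * V"
    unfolding T2_def
    using order_trans[OF measure_sweep_band[OF T1(1-3) b(2) \<epsilon>] mult_left_mono[OF V]] \<epsilon> cardD by simp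
  have "measure lebesgue (T2 - A) \<le> measure lebesgue ((T - A) \<union> ((T1 - T) \<union> (T2 - T1)))"
    using T T1 T2 A by (intro measure_mono_fmeasurable fmeasurable.Un lm) (auto intro!: lm fmeasurableD)
  also have "\<dots> \<le> measure lebesgue (T - A) + measure lebesgue ((T1 - T) \<union> (T2 - T1))"
    using T T1 T2 A by (intro measure_Un_le fmeasurableD fmeasurable.Un lm)
  also have "measure lebesgue ((T1 - T) \<union> (T2 - T1)) \<le> measure lebesgue (T1 - T) + measure lebesgue (T2 - T1)"
    using T T1 T2 A by (intro measure_Un_le fmeasurableD fmeasurable.Un lm)
  finally have "measure lebesgue (T2 - A) \<le> 2 * real (card (insert b S)) * \<epsilon> * V"
    using m1 m2 T(4) unfolding card by (simp add: algebra_simps)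
  moreover have "a + (\<Sum>b\<in>insert b S. c b *\<^sub>R b) \<in> T2"
    if "a \<in> A" and c: "\<forall>b\<in>insert b S. \<bar>c b\<bar> \<le> \<epsilon>" for a c
  proof -
    define x where "x = a + (\<Sum>b\<in>S. c b *\<^sub>R b)"
    have "x \<in> T" unfolding x_def using T(5) that by auto
    \<comment> \<open>The positive part of \<open>c b\<close> is realised by the forward sweep and
      the negative part by the backward one.\<close>
    have "x + max 0 (c b) *\<^sub>R b \<in> T1"
      unfolding T1_def sweep_def using \<open>x \<in> T\<close> c \<epsilon> by (force intro!: image_eqI[of _ _ "(x, max 0 (c b))"])
    then have "(x + max 0 (c b) *\<^sub>R b) + max 0 (- c b) *\<^sub>R (- b) \<in> T2"
      unfolding T2_def sweep_def using c \<epsilon>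
      by (intro image_eqI[of _ _ "(x + max 0 (c b) *\<^sub>R b, max 0 (- c b))"]) (auto simp: abs_le_iff)
    moreover have "(x + max 0 (c b) *\<^sub>R b) + max 0 (- c b) *\<^sub>R (- b) = x + c b *\<^sub>R b"
      by (simp add: max_def)
    ultimately show ?thesis using insert by (simp add: x_def algebra_simps)
  qed
  moreover have "T2 \<subseteq> cball 0 (L + 2 * real (card (insert b S)))"
    using T2(3) \<epsilon> unfolding card by (force simp: algebra_simps)
  ultimately show ?case
    using T2 unfolding V_def by (intro exI[of _ T2]) auto
qed

text \<open>A point within \<epsilon> of \<open>A\<close> differs from some point of
  \<open>A\<close> by at most \<epsilon> in each coordinate, hence lies in the thickening of
  \<open>A\<close> along all axes. The constant depends on the space alone.\<close>

lemma measure_diff_le_of_near: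
  shows "\<exists>K>0. \<forall>(A::'a::euclidean_space set) B \<epsilon>. convex A \<longrightarrow> compact A \<longrightarrow> compact B \<longrightarrow>
     A \<subseteq> cbox 0 One \<longrightarrow> B \<subseteq> cbox 0 One \<longrightarrow> 0 < \<epsilon> \<longrightarrow> (\<forall>x\<in>B. \<exists>a\<in>A. dist x a \<le> \<epsilon>) \<longrightarrow>
     measure lborel (B - A) \<le> K * \<epsilon>"
proof -
  obtain L where L: "cbox 0 One \<subseteq> cball (0::'a) L"
    using bounded_cbox[of "0::'a" One] unfolding bounded_iff by (auto simp: subset_iff)
  define V where "V = measure lebesgue (cball (0::'a) (L + 2 * real DIM('a) + 2))"
  \<comment> \<open>The summand 1 gives \<open>K \<ge> 1\<close>, which settles \<epsilon> > 1
    because the cube has volume 1.\<close>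
  define K where "K = 2 * real DIM('a) * V + 1"
  have V: "V \<ge> 0" by (simp add: V_def)
  have "measure lborel (B - A) \<le> K * \<epsilon>"
    if A: "convex A" "compact A" "A \<subseteq> cbox 0 One" and B: "compact B" "B \<subseteq> cbox 0 One"
      and \<epsilon>: "0 < \<epsilon>" and near: "\<forall>x\<in>B. \<exists>a\<in>A. dist x a \<le> \<epsilon>" for A B :: "'a set" and \<epsilon>
  proof -
    have eq: "measure lborel (B - A) = measure lebesgue (B - A)"
      using A(2) B(1) by (simp add: compact_imp_closed borel_closed)
    have lm: "X - A \<in> lmeasurable" if "compact X" for X :: "'a set"
      using that A by (intro fmeasurable.Diff lmeasurable_compact)
    show ?thesis
    proof (cases "\<epsilon> \<le> 1")
      case True
      obtain T where T: "compact T" "measure lebesgue (T - A) \<le> 2 * real DIM('a) * \<epsilon> * V"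
        "\<forall>a\<in>A. \<forall>c. (\<forall>b\<in>Basis. \<bar>c b\<bar> \<le> \<epsilon>) \<longrightarrow> a + (\<Sum>b\<in>Basis. c b *\<^sub>R b) \<in> T"
        using thicken_along_axes[OF A(1,2) order_trans[OF A(3) L] \<epsilon> True, of Basis] unfolding V_def by auto
      have "B \<subseteq> T"
      proof
        fix x assume "x \<in> B"
        then obtain a where a: "a \<in> A" "norm (x - a) \<le> \<epsilon>" using near by (auto simp: dist_norm)
        have "\<forall>b\<in>Basis. \<bar>(x - a) \<bullet> b\<bar> \<le> \<epsilon>"
          using a(2) Basis_le_norm order_trans by blast
        then have "a + (\<Sum>b\<in>Basis. ((x - a) \<bullet> b) *\<^sub>R b) \<in> T" using T(3) a(1) by blast
        then show "x \<in> T" by (simp add: euclidean_representation)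
      qed
      then have "measure lebesgue (B - A) \<le> measure lebesgue (T - A)"
        using lm[OF T(1)] lm[OF B(1)] by (intro measure_mono_fmeasurable) auto
      also have "\<dots> \<le> K * \<epsilon>" using T(2) \<epsilon> by (simp add: K_def algebra_simps)
      finally show ?thesis unfolding eq .
    next
      case False
      have "measure lebesgue (B - A) \<le> measure lebesgue (cbox (0::'a) One)"
        using lm[OF B(1)] B(2) by (intro measure_mono_fmeasurable) auto
      also have "\<dots> = 1" by (simp add: content_cbox)
      also have "1 \<le> K * \<epsilon>" using False V
        by (intro order_trans[OF _ mult_mono[of 1 K 1 \<epsilon>]]) (auto simp: K_def)
      finally show ?thesis unfolding eq .
    qed
  qed
  moreover have "K > 0" using V unfolding K_def by (simp add: add_nonneg_pos)
  ultimately show ?thesis by blast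
qed

section \<open>Grid polytopes close to a convex body\<close>

text \<open>The closed neighbourhood of radius \<epsilon> of a convex hull is a Minkowski sum with a
  ball, hence convex; once it contains \<open>X\<close> it contains the hull of
  \<open>X\<close>.\<close>

lemma convex_hull_near:
  fixes X Y :: "'a::real_normed_vector set"
  assumes near: "\<And>x. x \<in> X \<Longrightarrow> \<exists>y\<in>Y. dist x y \<le> \<epsilon>" and p: "p \<in> convex hull X"
  shows "\<exists>q \<in> convex hull Y. dist p q \<le> \<epsilon>"
proof -
  let ?N = "\<Union>q\<in>convex hull Y. \<Union>v\<in>cball 0 \<epsilon>. {q + v}"
  have "X \<subseteq> ?N"
  proof
    fix x assume "x \<in> X"
    then obtain y where "y \<in> Y" "dist x y \<le> \<epsilon>" using near by blast
    then show "x \<in> ?N"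
      by (intro UN_I[of y "convex hull Y"] UN_I[of "x - y" "cball 0 \<epsilon>"]) (auto simp: hull_inc dist_norm norm_minus_commute)
  qed
  moreover have "convex ?N" by (intro convex_sums convex_convex_hull convex_cball)
  ultimately have "p \<in> ?N" using p hull_minimal[of X ?N convex] by blast
  then obtain q v where "q \<in> convex hull Y" "norm v \<le> \<epsilon>" "p = q + v" by auto
  then show ?thesis by (intro bexI[of _ q]) (auto simp: dist_norm)
qed

lemma round_to_grid:
  fixes x :: "'a::euclidean_space"
  assumes "x \<in> cbox 0 One" "n \<ge> (1::nat)"
  shows "\<exists>y \<in> cbox 0 One. (\<forall>b\<in>Basis. \<exists>k::int. y \<bullet> b = of_int k / of_nat n) \<and> dist x y \<le> DIM('a) / n"
proof -
  define y where "y = (\<Sum>b\<in>Basis. (of_int \<lfloor>n * (x \<bullet> b)\<rfloor> / real n) *\<^sub>R b)"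
  have yb: "y \<bullet> b = of_int \<lfloor>n * (x \<bullet> b)\<rfloor> / real n" if "b \<in> Basis" for b
    using that by (simp add: y_def)
  have bd: "0 \<le> y \<bullet> b \<and> y \<bullet> b \<le> 1 \<and> \<bar>(x - y) \<bullet> b\<bar> \<le> 1 / n" if b: "b \<in> Basis" for b
  proof -
    have x: "0 \<le> x \<bullet> b" "x \<bullet> b \<le> 1" using assms(1) b by (auto simp: mem_box)
    define f :: real where "f = of_int \<lfloor>n * (x \<bullet> b)\<rfloor>"
    have f: "0 \<le> f" "f \<le> n * (x \<bullet> b)" "n * (x \<bullet> b) - f \<le> 1"
      unfolding f_def using x by (simp, linarith+)
    have "n * (x \<bullet> b) \<le> n" using x by (simp add: mult_left_le)
    then have "f \<le> n" using f by linarith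
    then have "0 \<le> f / n" "f / n \<le> 1" using f assms(2) by auto
    moreover have "(x - y) \<bullet> b = (n * (x \<bullet> b) - f) / n"
      using assms(2) by (simp add: inner_diff_left yb[OF b] f_def field_simps)
    moreover have "\<bar>(n * (x \<bullet> b) - f) / n\<bar> \<le> 1 / n"
      using f by (simp add: divide_right_mono)
    ultimately show ?thesis unfolding yb[OF b] f_def by simp
  qed
  have "dist x y \<le> (\<Sum>b\<in>(Basis::'a set). 1 / n)"
    unfolding dist_norm using bd by (intro order_trans[OF norm_le_l1] sum_mono) auto
  then show ?thesis
    using bd yb by (intro bexI[of _ y]) (auto simp: mem_box)
qed

text \<open>Rounding can leave a flat hull. Adding to one grid point its neighbours at distance
  \<open>1 / n\<close>, one along each axis, makes the interior nonempty, since orthogonal nonzero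
  edges span a full simplex.\<close>

lemma grid_simplex:
  fixes x :: "'a::euclidean_space"
  assumes x: "x \<in> cbox 0 One" "\<forall>b\<in>Basis. \<exists>k::int. x \<bullet> b = of_int k / of_nat n" and n: "n \<ge> (1::nat)"
  obtains W where "finite W" "card W \<le> DIM('a)" "W \<subseteq> cbox 0 One"
    "\<And>w b. \<lbrakk>w \<in> W; b \<in> Basis\<rbrakk> \<Longrightarrow> \<exists>k::int. w \<bullet> b = of_int k / of_nat n"
    "\<And>w. w \<in> W \<Longrightarrow> dist x w \<le> 1 / n" "interior (convex hull (insert x W)) \<noteq> {}"
proof -
  \<comment> \<open>A nonzero coordinate is at least \<open>1 / n\<close>, so stepping down stays in
    the cube; from 0 the step goes up.\<close>
  define s :: "'a \<Rightarrow> int" where "s b = (if x \<bullet> b = 0 then 1 else -1)" for b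
  define v where "v b = (of_int (s b) / real n) *\<^sub>R b" for b :: 'a
  have s: "\<bar>s b\<bar> = 1" "s b \<noteq> 0" for b by (auto simp: s_def)
  define W where "W = (\<lambda>b. x + v b) ` Basis"
  have in_cube: "0 \<le> x \<bullet> b + of_int (s b) / real n \<and> x \<bullet> b + of_int (s b) / real n \<le> 1" if b: "b \<in> Basis" for b
  proof -
    have x1: "0 \<le> x \<bullet> b" "x \<bullet> b \<le> 1" using x(1) b by (auto simp: mem_box)
    obtain k :: int where k: "x \<bullet> b = of_int k / of_nat n" using x(2) b by blast
    show ?thesis
    proof (cases "x \<bullet> b = 0")
      case True
      then show ?thesis using n by (simp add: s_def)
    next
      case False
      then have "k > 0" using x1(1) n k by (auto simp: zero_le_divide_iff)
      then have "1 / real n \<le> x \<bullet> b" unfolding k by (simp add: divide_right_mono)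
      moreover have "0 \<le> 1 / real n" by simp
      moreover have "of_int (s b) / real n = - (1 / real n)" using False by (simp add: s_def)
      ultimately show ?thesis using x1 by linarith
    qed
  qed
  have vb: "(x + v b) \<bullet> c = (if c = b then x \<bullet> b + of_int (s b) / real n else x \<bullet> c)"
    if "b \<in> Basis" "c \<in> Basis" for b c
    using that by (auto simp: v_def inner_add_left inner_Basis)
  have "W \<subseteq> cbox 0 One"
    using in_cube x(1) by (auto simp: W_def mem_box vb)
  moreover have "\<exists>k::int. w \<bullet> c = of_int k / of_nat n" if w: "w \<in> W" and c: "c \<in> Basis" for w c
  proof -
    obtain b where b: "b \<in> Basis" "w = x + v b" using w by (auto simp: W_def)
    obtain k :: int where k: "x \<bullet> c = of_int k / of_nat n" using x(2) c by blast
    have "w \<bullet> c = of_int (if c = b then k + s b else k) / of_nat n"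
      using k unfolding b(2) vb[OF b(1) c] by (auto simp: add_divide_distrib)
    then show ?thesis by blast
  qed
  moreover have "dist x w \<le> 1 / n" if "w \<in> W" for w
    using that s by (auto simp: W_def v_def dist_norm simp flip: of_int_abs)
  moreover have "interior (convex hull (insert x W)) \<noteq> {}"
  proof -
    have inj: "inj_on v Basis"
      using s n unfolding v_def inj_on_def
      by (metis Basis_zero divide_eq_0_iff inner_Basis inner_scaleR_left inner_zero_left mult_cancel_left2 not_one_le_zero of_int_eq_0_iff of_nat_eq_0_iff scaleR_eq_0_iff)
    have "pairwise orthogonal (v ` Basis)"
      unfolding pairwise_image pairwise_def by (auto simp: v_def orthogonal_def inner_Basis)
    then have "independent (v ` Basis)"
      using s n by (intro pairwise_orthogonal_independent) (auto simp: v_def)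
    then obtain a where "a \<in> interior (convex hull (insert 0 (v ` Basis)))"
      using interior_simplex_nonempty[of "v ` Basis"] inj by (auto simp: card_image)
    moreover have "insert x W = (+) x ` insert 0 (v ` Basis)"
      by (auto simp: W_def)
    then have "interior (convex hull (insert x W)) = (+) x ` interior (convex hull (insert 0 (v ` Basis)))"
      by (simp only: convex_hull_translation interior_translation)
    ultimately show ?thesis by auto
  qed
  moreover have "finite W" "card W \<le> DIM('a)" by (auto simp: W_def card_image_le)
  ultimately show ?thesis using that by blast
qed

text \<open>The constructed hull and \<open>C\<close> are each contained in a small neighbourhood of
  the other. As both are convex, \<open>measure_diff_le_of_near\<close> applies in both directions
  and bounds the two halves of the symmetric difference.\<close>

lemma grid_hull_approximation:
  shows "\<exists>K>0. \<forall>(C::'a::euclidean_space set) (n::nat) (m::nat).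
    convex C \<longrightarrow> compact C \<longrightarrow> C \<noteq> {} \<longrightarrow> C \<subseteq> cbox 0 One \<longrightarrow> n \<ge> 1 \<longrightarrow> m \<ge> 1 \<longrightarrow>
    (\<exists>X. finite X \<and> X \<subseteq> cbox 0 One \<and> (\<forall>x\<in>X. \<forall>b\<in>Basis. \<exists>k::int. x \<bullet> b = of_int k / of_nat n) \<and>
      card X \<le> 2 * DIM('a) * (2 * m + 1) ^ (DIM('a) - 1) + DIM('a) \<and>
      interior (convex hull X) \<noteq> {} \<and>
      measure lborel (sym_diff (convex hull X) C) \<le> K * (1 / (real m)\<^sup>2 + 1 / real n))"
proof -
  obtain K where K: "K > 0" and vol: "\<And>(A::'a set) B \<epsilon>. \<lbrakk>convex A; compact A; compact B;
     A \<subseteq> cbox 0 One; B \<subseteq> cbox 0 One; 0 < \<epsilon>; \<forall>x\<in>B. \<exists>a\<in>A. dist x a \<le> \<epsilon>\<rbrakk>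
     \<Longrightarrow> measure lborel (B - A) \<le> K * \<epsilon>"
    using measure_diff_le_of_near[where 'a='a] by blast
  define d where "d = real DIM('a)"
  have d: "d \<ge> 1" by (simp add: d_def Suc_leI)
  have "\<exists>X. finite X \<and> X \<subseteq> cbox 0 One \<and> (\<forall>x\<in>X. \<forall>b\<in>Basis. \<exists>k::int. x \<bullet> b = of_int k / of_nat n) \<and>
      card X \<le> 2 * DIM('a) * (2 * m + 1) ^ (DIM('a) - 1) + DIM('a) \<and>
      interior (convex hull X) \<noteq> {} \<and>
      measure lborel (sym_diff (convex hull X) C) \<le> (8 * d\<^sup>2 * K) * (1 / (real m)\<^sup>2 + 1 / real n)"
    if C: "convex C" "compact C" "C \<noteq> {}" "C \<subseteq> cbox 0 One" and n: "n \<ge> 1" and m: "m \<ge> 1"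
    for C :: "'a set" and n m :: nat
  proof -
    obtain Z :: "'a set" where Z: "finite Z" "Z \<noteq> {}"
      "card Z \<le> 2 * DIM('a) * (2 * m + 1) ^ (DIM('a) - 1)"
      and net: "\<And>x u. \<lbrakk>x \<in> cbox 0 One; norm u = 1\<rbrakk> \<Longrightarrow>
         \<exists>t\<ge>1. \<exists>z\<in>Z. norm (x + t *\<^sub>R u - z) \<le> 2 * DIM('a) / m"
      using cube_boundary_net[OF m, where 'a='a] by blast
    define X0 where "X0 = closest_point C ` Z"
    have X0: "X0 \<subseteq> C" "X0 \<noteq> {}" "finite X0"
      using C Z by (auto simp: X0_def intro!: closest_point_in_set compact_imp_closed)
    have nearC: "\<exists>p\<in>convex hull X0. dist y p \<le> (2 * d / m)\<^sup>2" if "y \<in> C" for y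
      using near_hull_of_projected_net[OF C(1-3) Z(1,2) _ that, of "2 * d / m"] net subsetD[OF C(4)]
      unfolding X0_def d_def of_nat_mult by (metis of_nat_numeral)
    obtain g where g: "\<And>x. x \<in> X0 \<Longrightarrow> g x \<in> cbox 0 One \<and>
        (\<forall>b\<in>Basis. \<exists>k::int. g x \<bullet> b = of_int k / of_nat n) \<and> dist x (g x) \<le> d / n"
      using round_to_grid[OF _ n, where 'a='a] X0(1) C(4) unfolding d_def by (metis subset_iff)
    obtain x0 where x0: "x0 \<in> X0" using X0(2) by blast
    obtain W where W: "finite W" "card W \<le> DIM('a)" "W \<subseteq> cbox 0 One"
      "\<And>w b. \<lbrakk>w \<in> W; b \<in> Basis\<rbrakk> \<Longrightarrow> \<exists>k::int. w \<bullet> b = of_int k / of_nat n"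
      "\<And>w. w \<in> W \<Longrightarrow> dist (g x0) w \<le> 1 / n" "interior (convex hull (insert (g x0) W)) \<noteq> {}"
      using grid_simplex[of "g x0" n] g[OF x0] n by blast
    define X where "X = g ` X0 \<union> W"
    have finX: "finite X" using X0 W by (simp add: X_def)
    have cube: "X \<subseteq> cbox 0 One" using g W(3) by (auto simp: X_def)
    have grid: "\<forall>x\<in>X. \<forall>b\<in>Basis. \<exists>k::int. x \<bullet> b = of_int k / of_nat n"
      using g W(4) by (auto simp: X_def)
    have "card (g ` X0) \<le> card Z"
      unfolding X0_def by (meson Z(1) card_image_le finite_imageI order_trans)
    then have card: "card X \<le> 2 * DIM('a) * (2 * m + 1) ^ (DIM('a) - 1) + DIM('a)"
      unfolding X_def using card_Un_le[of "g ` X0" W] Z(3) W(2) by linarith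
    have int: "interior (convex hull X) \<noteq> {}"
      using W(6) interior_mono[OF hull_mono[of "insert (g x0) W" X convex]] x0 by (auto simp: X_def)
    have one_d: "1 / n \<le> d / n" using d by (simp add: divide_right_mono)
    have pos: "0 \<le> 1 / real n" "0 < 1 / (real m)\<^sup>2" "0 < 1 / real n" "0 < d / n" using m n d by auto
    have hull_cube: "convex hull X \<subseteq> cbox 0 One"
      using cube by (intro hull_minimal) auto
    have cpt: "compact (convex hull X)" by (simp add: finX finite_imp_compact_convex_hull)
    \<comment> \<open>Before rounding, all vertices lie in \<open>C\<close>, so only rounding
      (\<open>d / n\<close>) and the added simplex (\<open>1 / n \<le> d / n\<close>) can leave
      it.\<close>
    have near1: "\<exists>c\<in>C. dist p c \<le> 2 * d / n" if pX: "p \<in> convex hull X" for p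
    proof -
      have "\<exists>y\<in>X0. dist x y \<le> 2 * d / n" if xX: "x \<in> X" for x
      proof (cases "x \<in> W")
        case True
        have "dist x x0 \<le> dist x0 (g x0) + dist (g x0) x" by (metis dist_commute dist_triangle)
        also have "\<dots> \<le> d / n + 1 / n" using g[OF x0] W(5)[OF True] by (intro add_mono) auto
        also have "\<dots> \<le> 2 * d / n" using one_d by simp
        finally show ?thesis using x0 by blast
      next
        case False
        then obtain y where "y \<in> X0" "x = g y" using xX by (auto simp: X_def)
        then show ?thesis using g[of y] pos(4) by (intro bexI[of _ y]) (auto simp: dist_commute)
      qed
      then obtain q where "q \<in> convex hull X0" "dist p q \<le> 2 * d / n"
        using convex_hull_near[OF _ pX] by blast
      moreover have "convex hull X0 \<subseteq> C" using X0(1) C(1) by (intro hull_minimal) auto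
      ultimately show ?thesis by blast
    qed
    have near2: "\<exists>p\<in>convex hull X. dist c p \<le> (2 * d / m)\<^sup>2 + d / n" if cC: "c \<in> C" for c
    proof -
      obtain q where q: "q \<in> convex hull X0" "dist c q \<le> (2 * d / m)\<^sup>2" using nearC[OF cC] by blast
      have "\<exists>y\<in>X. dist x y \<le> d / n" if "x \<in> X0" for x
        using g[OF that] that by (auto simp: X_def)
      then obtain p where "p \<in> convex hull X" "dist q p \<le> d / n"
        using convex_hull_near[OF _ q(1)] by blast
      then show ?thesis using q(2) dist_triangle[of c p q] by (intro bexI[of _ p]) auto
    qed
    have v1: "measure lborel (convex hull X - C) \<le> K * (2 * d / n)"
      using vol[OF C(1,2) cpt C(4) hull_cube, of "2 * d / n"] near1 pos by auto
    have v2: "measure lborel (C - convex hull X) \<le> K * ((2 * d / m)\<^sup>2 + d / n)"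
      using vol[OF _ cpt C(2) hull_cube C(4), of "(2 * d / m)\<^sup>2 + d / n"] near2
        add_nonneg_pos[OF zero_le_power2 pos(4), of "2 * d / m"]
      by auto
    have "measure lborel (sym_diff (convex hull X) C)
        \<le> measure lborel (convex hull X - C) + measure lborel (C - convex hull X)"
      using cpt C(2) by (intro measure_Un_le sets.Diff) (simp_all add: borel_closed compact_imp_closed)
    also have "\<dots> \<le> K * (2 * d / n) + K * ((2 * d / m)\<^sup>2 + d / n)" using v1 v2 by linarith
    also have "\<dots> = K * (4 * d\<^sup>2 * (1 / (real m)\<^sup>2) + 3 * d * (1 / n))"
      by (simp add: power_divide power_mult_distrib algebra_simps add_divide_distrib)
    \<comment> \<open>As \<open>d \<ge> 1\<close>, one coefficient dominates both the quadratic and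
      the linear one.\<close>
    also have "\<dots> \<le> K * (8 * d\<^sup>2 * (1 / (real m)\<^sup>2) + 8 * d\<^sup>2 * (1 / n))"
    proof -
      have "d \<le> d\<^sup>2" using d by (simp add: power2_eq_square)
      then show ?thesis
        using K pos d by (intro mult_left_mono add_mono mult_right_mono) auto
    qed
    also have "\<dots> = (8 * d\<^sup>2 * K) * (1 / (real m)\<^sup>2 + 1 / real n)" by (simp add: algebra_simps)
    finally show ?thesis using finX cube grid card int by blast
  qed
  moreover have "8 * d\<^sup>2 * K > 0" using d K by simp
  ultimately show ?thesis by blast
qed

section \<open>Exponential deviation of the contrast\<close>

lemma unit_cube_eq_cbox: "unit_cube = cbox (0 :: real ^ 'd) One"
proof (rule set_eqI)
  fix x :: "real ^ 'd"
  have "x \<in> cbox 0 One \<longleftrightarrow> (\<forall>b\<in>Basis. 0 \<le> x \<bullet> b \<and> x \<bullet> b \<le> 1)" by (simp add: mem_box)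
  then show "x \<in> unit_cube \<longleftrightarrow> x \<in> cbox 0 One"
    by (auto simp: unit_cube_def Basis_vec_def inner_axis)
qed

lemma emeasure_unit_cube: "emeasure lborel (unit_cube :: (real ^ 'd) set) = 1"
  unfolding unit_cube_eq_cbox by (subst emeasure_lborel_cbox_eq) simp

lemma measure_le_1_of_subset_unit_cube:
  fixes S :: "(real ^ 'd) set"
  assumes "S \<subseteq> unit_cube"
  shows "measure lborel S \<le> 1"
proof -
  have "emeasure lborel S \<le> 1"
    using emeasure_mono[OF assms, of lborel] emeasure_unit_cube
    by (simp add: unit_cube_eq_cbox)
  then show ?thesis unfolding measure_def using enn2real_mono[of _ 1] by auto
qed

lemma grid_polytopesD:
  assumes "P \<in> grid_polytopes n r"
  shows "compact P" "convex P" "P \<subseteq> unit_cube" "P \<in> sets borel"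
  using assms by (auto simp: grid_polytopes_def polytope_imp_compact polytope_imp_convex
      intro!: borel_closed compact_imp_closed)

text \<open>A polytope is the hull of its extreme points, so it is determined by a list of
  \<open>r\<close> grid points, and the cube contains at most \<open>(n + 1) ^ CARD('d)\<close> of
  these.\<close>

lemma finite_grid_polytopes:
  assumes n: "n \<ge> 1"
  shows "finite (grid_polytopes n r :: (real ^ 'd) set set)"
    and "card (grid_polytopes n r :: (real ^ 'd) set set) \<le> ((n + 1) ^ CARD('d)) ^ r"
proof -
  define G where "G = (\<lambda>f. \<chi> i. real (f i) / real n) ` ((UNIV :: 'd set) \<rightarrow>\<^sub>E {0..n})"
  have finG: "finite G" unfolding G_def by (intro finite_imageI finite_PiE) auto
  have "card G \<le> card ((UNIV :: 'd set) \<rightarrow>\<^sub>E {0..n})"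
    unfolding G_def by (intro card_image_le finite_PiE) auto
  then have cardG: "card G \<le> (n + 1) ^ CARD('d)" by (simp add: card_PiE)
  have inG: "v \<in> G" if v: "v \<in> unit_cube" "\<forall>i. \<exists>k::int. v $ i = of_int k / of_nat n" for v
  proof -
    obtain k :: "'d \<Rightarrow> int" where k: "\<And>i. v $ i = of_int (k i) / of_nat n" using v(2) by metis
    have k01: "0 \<le> k i \<and> k i \<le> int n" for i
    proof -
      have "0 \<le> v $ i" "v $ i \<le> 1" using v(1) by (auto simp: unit_cube_def)
      then have "0 \<le> real_of_int (k i)" "real_of_int (k i) \<le> real n"
        unfolding k using n by (simp_all add: zero_le_divide_iff divide_le_eq_1)
      then show ?thesis by linarith
    qed
    then have "v = (\<chi> i. real (nat (k i)) / real n)"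
      by (simp add: vec_eq_iff k)
    moreover have "(\<lambda>i. nat (k i)) \<in> (UNIV :: 'd set) \<rightarrow>\<^sub>E {0..n}" using k01 by (auto simp: nat_le_iff)
    ultimately show ?thesis unfolding G_def by (rule image_eqI)
  qed
  let ?L = "{xs. set xs \<subseteq> G \<and> length xs = r}"
  have sub: "grid_polytopes n r \<subseteq> (\<lambda>xs. convex hull (set xs)) ` ?L"
  proof
    fix P :: "(real ^ 'd) set" assume P: "P \<in> grid_polytopes n r"
    define E where "E = {v. v extreme_point_of P}"
    have hull: "P = convex hull E"
      unfolding E_def using Krein_Milman_Minkowski grid_polytopesD[OF P] by blast
    have EG: "E \<subseteq> G"
    proof
      fix v assume v: "v \<in> E"
      then have "v \<in> P" by (auto simp: E_def extreme_point_of_def)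
      then show "v \<in> G" using inG[of v] grid_polytopesD(3)[OF P] P v
        by (auto simp: grid_polytopes_def E_def)
    qed
    then have finE: "finite E" using finG finite_subset by blast
    have cardE: "card E \<le> r" using P by (simp add: grid_polytopes_def E_def)
    have "P \<noteq> {}" using P by (auto simp: grid_polytopes_def)
    then have "E \<noteq> {}" unfolding hull by auto
    obtain ys where ys: "set ys = E" "distinct ys" using finE finite_distinct_list by blast
    \<comment> \<open>Repeating one vertex pads the list to length exactly \<open>r\<close> without
      changing the hull.\<close>
    define xs where "xs = ys @ replicate (r - card E) (hd ys)"
    have "ys \<noteq> []" using ys \<open>E \<noteq> {}\<close> by auto
    then have "set xs = E" using ys by (auto simp: xs_def)
    moreover have "length xs = r" using distinct_card[OF ys(2)] ys(1) cardE by (simp add: xs_def)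
    ultimately show "P \<in> (\<lambda>xs. convex hull (set xs)) ` ?L" using EG hull by auto
  qed
  have finL: "finite ?L" by (rule finite_lists_length_eq[OF finG])
  show "finite (grid_polytopes n r :: (real ^ 'd) set set)"
    using finite_subset[OF sub] finL by blast
  have "card (grid_polytopes n r :: (real ^ 'd) set set) \<le> card ?L"
    using card_mono[OF finite_imageI[OF finL] sub] card_image_le[OF finL, of "\<lambda>xs. convex hull (set xs)"]
    by (rule order_trans)
  also have "\<dots> = card G ^ r" by (rule card_lists_length_eq[OF finG])
  also have "\<dots> \<le> ((n + 1) ^ CARD('d)) ^ r" using cardG by (rule power_mono) simp
  finally show "card (grid_polytopes n r :: (real ^ 'd) set set) \<le> ((n + 1) ^ CARD('d)) ^ r" .
qed

section \<open>Expectations under the observation model\<close>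

lemma prob_space_uniform_cube: "prob_space (uniform_measure lborel (unit_cube :: (real ^ 'd) set))"
  by (intro prob_space_uniform_measure) (simp_all add: emeasure_unit_cube)

lemma measure_uniform_cube:
  fixes S :: "(real ^ 'd) set"
  assumes "S \<in> sets borel" "S \<subseteq> unit_cube"
  shows "measure (uniform_measure lborel unit_cube) S = measure lborel S"
proof -
  have "emeasure (uniform_measure lborel unit_cube) S = emeasure lborel S"
    using assms by (subst emeasure_uniform_measure)
      (auto simp: emeasure_unit_cube unit_cube_eq_cbox Int_absorb1 divide_ennreal_def)
  then show ?thesis by (simp add: measure_def)
qed

context
  fixes \<mu> :: "real measure" and C :: "(real ^ 'd) set"
  assumes mu: "prob_space \<mu>" "sets \<mu> = sets borel" and C: "C \<in> sets borel"
begin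

lemma measurable_observation:
  "(\<lambda>(x, \<xi>). (x, indicator C x + \<xi>)) \<in>
    (uniform_measure lborel (unit_cube :: (real ^ 'd) set) \<Otimes>\<^sub>M \<mu>) \<rightarrow>\<^sub>M (borel :: ((real ^ 'd) \<times> real) measure)"
proof -
  have [measurable_cong]: "sets \<mu> = sets borel" by (rule mu)
  have [measurable]: "C \<in> sets borel" by (rule C)
  show ?thesis unfolding borel_prod[symmetric] by measurable
qed

lemma prob_space_pair_law: "prob_space (pair_law \<mu> C)"
proof -
  interpret U: prob_space "uniform_measure lborel (unit_cube :: (real ^ 'd) set)"
    by (rule prob_space_uniform_cube)
  interpret N: prob_space \<mu> by (rule mu)
  interpret UN: pair_prob_space "uniform_measure lborel (unit_cube :: (real ^ 'd) set)" \<mu> ..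
  show ?thesis
    unfolding pair_law_def by (rule UN.prob_space_distr[OF measurable_observation])
qed

lemma nn_integral_pair_law:
  assumes f: "f \<in> borel_measurable (borel :: ((real ^ 'd) \<times> real) measure)"
  shows "(\<integral>\<^sup>+ z. f z \<partial>pair_law \<mu> C) =
    (\<integral>\<^sup>+ x. \<integral>\<^sup>+ \<xi>. f (x, indicator C x + \<xi>) \<partial>\<mu> \<partial>uniform_measure lborel unit_cube)"
proof -
  interpret N: prob_space \<mu> by (rule mu)
  show ?thesis
    unfolding pair_law_def
    using measurable_compose[OF measurable_observation f] f
    by (subst nn_integral_distr[OF measurable_observation], simp, subst N.nn_integral_fst[symmetric])
      (auto simp: case_prod_unfold)
qed

text \<open>Off the symmetric difference of \<open>P\<close> and \<open>Q\<close> the exponent vanishes; on it the increment of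
  the contrast is \<open>\<plusminus>1\<close> plus a noise term. The choice \<open>\<lambda> = 1 / (4 \<sigma>\<^sup>2)\<close> makes the subgaussian
  correction \<open>2 \<lambda>\<^sup>2 \<sigma>\<^sup>2\<close> half of \<open>\<lambda>\<close>.\<close>
lemma exp_moment_contrast_increment:
  fixes P Q :: "(real ^ 'd) set"
  assumes sub: "subgaussian \<sigma> \<mu>" and \<sigma>: "\<sigma> > 0" and CC: "C \<subseteq> unit_cube"
    and P: "P \<in> sets borel" "P \<subseteq> unit_cube" and Q: "Q \<in> sets borel" "Q \<subseteq> unit_cube"
  defines "\<kappa> \<equiv> 1 / (8 * \<sigma>\<^sup>2)"
  shows "(\<integral>\<^sup>+ z. ennreal (exp (- (2 * \<kappa>) * ((1 - 2 * snd z) * (indicator P (fst z) - indicator Q (fst z))))) \<partial>pair_law \<mu> C)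
    \<le> ennreal (exp ((exp (3 * \<kappa>) - exp (- \<kappa>)) * measure lborel (sym_diff Q C)
        - (1 - exp (- \<kappa>)) * measure lborel (sym_diff P C)))"
proof -
  let ?U = "uniform_measure lborel (unit_cube :: (real ^ 'd) set)"
  interpret U: prob_space ?U by (rule prob_space_uniform_cube)
  have [measurable]: "P \<in> sets borel" "Q \<in> sets borel" "C \<in> sets borel" by fact+
  have [measurable_cong]: "sets \<mu> = sets borel" by (rule mu)
  define a where "a = 1 - exp (- \<kappa>)"
  define b where "b = exp (3 * \<kappa>) - exp (- \<kappa>)"
  have \<kappa>: "\<kappa> > 0" "8 * \<kappa> * \<sigma>\<^sup>2 = 1" using \<sigma> by (auto simp: \<kappa>_def)
  have e: "exp (- \<kappa>) \<le> 1" "1 \<le> exp (3 * \<kappa>)" using \<kappa> by auto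
  \<comment> \<open>\<open>h\<close> dominates the noise average at \<open>x\<close> in each case:
    it equals \<open>exp (- \<kappa>)\<close> where only \<open>P\<close> disagrees with
    \<open>C\<close>, it is at least \<open>exp (3 * \<kappa>)\<close> where only \<open>Q\<close>
    does, and it is at least 1 where \<open>P\<close> and \<open>Q\<close> agree, since
    \<open>b \<ge> a\<close>. Being affine in indicators, it integrates to volumes.\<close>
  define h :: "real ^ 'd \<Rightarrow> real"
    where "h x = 1 + b * indicator (sym_diff Q C) x - a * indicator (sym_diff P C) x" for x
  have inner: "(\<integral>\<^sup>+ \<xi>. ennreal (exp (- (2 * \<kappa>) * ((1 - 2 * (indicator C x + \<xi>)) * (indicator P x - indicator Q x)))) \<partial>\<mu>)
      \<le> ennreal (h x)" for x
  proof -
    define s :: real where "s = indicator P x - indicator Q x"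
    define c :: real where "c = 1 - 2 * indicator C x"
    have "(\<integral>\<^sup>+ \<xi>. ennreal (exp (- (2 * \<kappa>) * ((1 - 2 * (indicator C x + \<xi>)) * s))) \<partial>\<mu>)
        = (\<integral>\<^sup>+ \<xi>. ennreal (exp (- 2 * \<kappa> * c * s)) * ennreal (exp ((4 * \<kappa> * s) * \<xi>)) \<partial>\<mu>)"
      by (intro nn_integral_cong) (simp add: c_def algebra_simps flip: ennreal_mult' exp_add)
    also have "\<dots> = ennreal (exp (- 2 * \<kappa> * c * s)) * (\<integral>\<^sup>+ \<xi>. ennreal (exp ((4 * \<kappa> * s) * \<xi>)) \<partial>\<mu>)"
      by (rule nn_integral_cmult) measurable
    also have "\<dots> \<le> ennreal (exp (- 2 * \<kappa> * c * s)) * ennreal (exp ((4 * \<kappa> * s)\<^sup>2 * \<sigma>\<^sup>2 / 2))"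
      using sub unfolding subgaussian_def by (intro mult_left_mono) auto
    also have "\<dots> = ennreal (exp (- 2 * \<kappa> * c * s + (4 * \<kappa> * s)\<^sup>2 * \<sigma>\<^sup>2 / 2))"
      by (simp only: exp_add ennreal_mult'[OF exp_ge_zero])
    also have "(4 * \<kappa> * s)\<^sup>2 * \<sigma>\<^sup>2 / 2 = (8 * \<kappa> * \<sigma>\<^sup>2) * (\<kappa> * s\<^sup>2)"
      by (simp add: power2_eq_square)
    also have "\<dots> = \<kappa> * s\<^sup>2" using \<kappa> by simp
    also have "exp (- 2 * \<kappa> * c * s + \<kappa> * s\<^sup>2) \<le> h x"
      using e unfolding s_def c_def h_def a_def b_def
      by (auto simp: indicator_def)
    finally show ?thesis unfolding s_def by (simp add: ennreal_leI)
  qed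
  have h0: "h x \<ge> 0" for x
    using e by (auto simp: h_def a_def b_def indicator_def)
  have ind: "integrable ?U (indicator S :: _ \<Rightarrow> real)" if "S \<in> sets borel" for S
    using that by (intro integrable_real_indicator) (auto simp: less_top[symmetric])
  have int_h: "integrable ?U h"
    unfolding h_def by (intro Bochner_Integration.integrable_diff Bochner_Integration.integrable_add
      Bochner_Integration.integrable_mult_right U.integrable_const ind) auto
  have "(\<integral>\<^sup>+ z. ennreal (exp (- (2 * \<kappa>) * ((1 - 2 * snd z) * (indicator P (fst z) - indicator Q (fst z))))) \<partial>pair_law \<mu> C)
    \<le> (\<integral>\<^sup>+ x. ennreal (h x) \<partial>?U)"
  proof (subst nn_integral_pair_law)
    show "(\<lambda>z. ennreal (exp (- (2 * \<kappa>) * ((1 - 2 * snd z) * (indicator P (fst z) - indicator Q (fst z))))))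
      \<in> borel_measurable borel"
      unfolding borel_prod[symmetric] by measurable
  qed (use inner in \<open>auto intro!: nn_integral_mono\<close>)
  also have "\<dots> = ennreal (\<integral> x. h x \<partial>?U)"
    by (intro nn_integral_eq_integral) (auto simp: h0 int_h)
  also have "(\<integral> x. h x \<partial>?U) = 1 + b * measure ?U (sym_diff Q C) - a * measure ?U (sym_diff P C)"
    unfolding h_def by (simp add: ind U.prob_space[simplified])
  also have "measure ?U (sym_diff Q C) = measure lborel (sym_diff Q C)"
    using Q CC by (intro measure_uniform_cube) auto
  also have "measure ?U (sym_diff P C) = measure lborel (sym_diff P C)"
    using P CC by (intro measure_uniform_cube) auto
  \<comment> \<open>The exponential form lets the bounds for the single pairs multiply by adding
    exponents.\<close>
  also have "1 + b * measure lborel (sym_diff Q C) - a * measure lborel (sym_diff P C)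
      \<le> exp (b * measure lborel (sym_diff Q C) - a * measure lborel (sym_diff P C))"
    using exp_ge_add_one_self[of "b * measure lborel (sym_diff Q C) - a * measure lborel (sym_diff P C)"]
    by (simp only: add_diff_eq)
  finally show ?thesis unfolding a_def b_def by (simp add: ennreal_leI)
qed

text \<open>The contrast is a sum over the sample, so its exponential is a product, and independence
  multiplies the one-pair bounds.\<close>

lemma exp_moment_contrast:
  fixes P Q :: "(real ^ 'd) set"
  assumes sub: "subgaussian \<sigma> \<mu>" and \<sigma>: "\<sigma> > 0" and CC: "C \<subseteq> unit_cube"
    and P: "P \<in> sets borel" "P \<subseteq> unit_cube" and Q: "Q \<in> sets borel" "Q \<subseteq> unit_cube"
  defines "\<kappa> \<equiv> 1 / (8 * \<sigma>\<^sup>2)"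
  shows "(\<integral>\<^sup>+ z. ennreal (exp (- (2 * \<kappa>) * (contrast n z P - contrast n z Q))) \<partial>sample_law \<mu> n C)
    \<le> ennreal (exp (n * ((exp (3 * \<kappa>) - exp (- \<kappa>)) * measure lborel (sym_diff Q C)
        - (1 - exp (- \<kappa>)) * measure lborel (sym_diff P C))))"
proof -
  define f where "f z = ennreal (exp (- (2 * \<kappa>) * ((1 - 2 * snd z) * (indicator P (fst z) - indicator Q (fst z)))))"
    for z :: "(real ^ 'd) \<times> real"
  define E where "E = (exp (3 * \<kappa>) - exp (- \<kappa>)) * measure lborel (sym_diff Q C)
        - (1 - exp (- \<kappa>)) * measure lborel (sym_diff P C)"
  have [measurable]: "P \<in> sets borel" "Q \<in> sets borel" by fact+
  interpret pair: prob_space "pair_law \<mu> C" by (rule prob_space_pair_law)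
  interpret product_sigma_finite "\<lambda>i::nat. pair_law \<mu> C" ..
  have f: "f \<in> borel_measurable (pair_law \<mu> C)"
    unfolding f_def pair_law_def measurable_distr_eq1 borel_prod[symmetric] by measurable
  have "ennreal (exp (- (2 * \<kappa>) * (contrast n z P - contrast n z Q))) = (\<Prod>i\<in>{1..n}. f (z i))" for z
  proof -
    have "- (2 * \<kappa>) * (contrast n z P - contrast n z Q)
        = (\<Sum>i = 1..n. - (2 * \<kappa>) * ((1 - 2 * snd (z i)) * (indicator P (fst (z i)) - indicator Q (fst (z i)))))"
      unfolding contrast_def by (simp add: right_diff_distrib sum_subtractf flip: sum_distrib_left)
    then show ?thesis by (simp add: exp_sum f_def prod_ennreal)
  qed
  then have "(\<integral>\<^sup>+ z. ennreal (exp (- (2 * \<kappa>) * (contrast n z P - contrast n z Q))) \<partial>sample_law \<mu> n C)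
      = (\<Prod>i\<in>{1..n}. \<integral>\<^sup>+ z. f z \<partial>pair_law \<mu> C)"
    unfolding sample_law_def using product_nn_integral_prod[of "{1..n}" "\<lambda>_. f"] f by simp
  also have "\<dots> \<le> (\<Prod>i\<in>{1..n}. ennreal (exp E))"
    using exp_moment_contrast_increment[OF sub \<sigma> CC P Q] unfolding f_def E_def \<kappa>_def
    by (intro prod_mono_ennreal) simp
  also have "\<dots> = ennreal (exp (n * E))"
    by (simp add: ennreal_power exp_of_nat_mult)
  finally show ?thesis unfolding E_def .
qed

text \<open>A loss of at most \<open>t\<close> contributes at most \<open>t powr q\<close>.
  Otherwise the estimate is one of the bad polytopes in \<open>F\<close>, and by minimality its
  contrast is at most that of \<open>Q\<close>, so its exponential term is at least 1 and dominates
  the loss, which never exceeds 1. Summing these terms over \<open>F\<close> is the union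
  bound.\<close>

lemma risk_bound:
  assumes sub: "subgaussian \<sigma> \<mu>" and \<sigma>: "\<sigma> > 0" and CC: "C \<subseteq> unit_cube"
    and est: "polytope_estimator n r Phat" and Q: "Q \<in> grid_polytopes n r" and n: "n \<ge> 1"
    and q: "q > 0" and t: "t \<ge> 0"
  defines "\<kappa> \<equiv> 1 / (8 * \<sigma>\<^sup>2)"
  shows "(\<integral>\<^sup>+ z. ennreal (measure lborel (sym_diff (Phat z) C) powr q) \<partial>sample_law \<mu> n C)
    \<le> ennreal (t powr q + real (card (grid_polytopes n r :: (real ^ 'd) set set)) *
        exp (n * ((exp (3 * \<kappa>) - exp (- \<kappa>)) * measure lborel (sym_diff Q C) - (1 - exp (- \<kappa>)) * t)))"
proof -
  let ?G = "grid_polytopes n r :: (real ^ 'd) set set"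
  define vol where "vol P = measure lborel (sym_diff P C)" for P
  define F where "F = {P \<in> ?G. vol P > t}"
  define b where "b = exp (3 * \<kappa>) - exp (- \<kappa>)"
  define a where "a = 1 - exp (- \<kappa>)"
  have a: "a \<ge> 0" and \<kappa>: "\<kappa> > 0" using \<sigma> by (auto simp: a_def \<kappa>_def)
  define g where "g P z = ennreal (exp (- (2 * \<kappa>) * (contrast n z P - contrast n z Q)))" for P z
  interpret pair: prob_space "pair_law \<mu> C" by (rule prob_space_pair_law)
  interpret S: prob_space "sample_law \<mu> n C"
    unfolding sample_law_def by (intro prob_space_PiM prob_space_pair_law)
  have finG: "finite ?G" by (rule finite_grid_polytopes[OF n])
  then have finF: "finite F" by (simp add: F_def)
  have sets_pair: "sets (pair_law \<mu> C) = sets borel" by (simp add: pair_law_def)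
  have sets_S: "sets (sample_law \<mu> n C) = sets (PiM {1..n} (\<lambda>i. borel))"
    unfolding sample_law_def by (intro sets_PiM_cong) (auto simp: sets_pair)
  have g_meas: "g P \<in> borel_measurable (sample_law \<mu> n C)" if "P \<in> sets borel" for P
  proof -
    have [measurable]: "P \<in> sets borel" "Q \<in> sets borel" using that grid_polytopesD[OF Q] by auto
    have [measurable_cong]: "sets (sample_law \<mu> n C) = sets (PiM {1..n} (\<lambda>i. borel \<Otimes>\<^sub>M borel))"
      by (simp only: sets_S borel_prod)
    show ?thesis unfolding g_def contrast_def by measurable
  qed
  have bound: "(\<integral>\<^sup>+ z. g P z \<partial>sample_law \<mu> n C) \<le> ennreal (exp (n * (b * vol Q - a * t)))" if "P \<in> F" for P
  proof -
    have P: "P \<in> ?G" "t \<le> vol P" using that by (auto simp: F_def)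
    have "(\<integral>\<^sup>+ z. g P z \<partial>sample_law \<mu> n C) \<le> ennreal (exp (n * (b * vol Q - a * vol P)))"
      unfolding g_def vol_def a_def b_def \<kappa>_def
      by (intro exp_moment_contrast[OF sub \<sigma> CC] grid_polytopesD[OF P(1)] grid_polytopesD[OF Q])
    also have "\<dots> \<le> ennreal (exp (n * (b * vol Q - a * t)))"
      using P a by (intro ennreal_leI) (simp add: mult_left_mono)
    finally show ?thesis .
  qed
  have "ennreal (vol (Phat z) powr q) \<le> ennreal (t powr q) + (\<Sum>P\<in>F. g P z)"
    if "z \<in> space (sample_law \<mu> n C)" for z
  proof -
    have "z \<in> space (PiM {1..n} (\<lambda>i. borel :: ((real ^ 'd) \<times> real) measure))"
      using that sets_eq_imp_space_eq[OF sets_S] by simp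
    then have arg: "is_arg_min (contrast n z) (\<lambda>P. P \<in> ?G) (Phat z)"
      using est unfolding polytope_estimator_def by blast
    then have Pz: "Phat z \<in> ?G" and le: "contrast n z (Phat z) \<le> contrast n z Q"
      using Q by (auto simp: is_arg_min_def not_less)
    show ?thesis
    proof (cases "vol (Phat z) > t")
      case True
      have "vol (Phat z) \<le> 1"
        unfolding vol_def using grid_polytopesD(3)[OF Pz] CC by (intro measure_le_1_of_subset_unit_cube) auto
      then have "vol (Phat z) powr q \<le> 1"
        using q by (intro powr_le1) (auto simp: vol_def)
      then have "ennreal (vol (Phat z) powr q) \<le> ennreal 1" by (rule ennreal_leI)
      also have "\<dots> \<le> g (Phat z) z"
        unfolding g_def using le \<kappa> by (intro ennreal_leI) (simp add: mult_nonneg_nonpos)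
      also have "\<dots> \<le> (\<Sum>P\<in>F. g P z)"
        using True Pz finF by (intro member_le_sum) (auto simp: F_def)
      finally show ?thesis by (simp add: add_increasing)
    next
      case False
      then have "vol (Phat z) powr q \<le> t powr q"
        using q by (intro powr_mono2) (auto simp: vol_def)
      then show ?thesis by (simp add: add_increasing2 ennreal_leI)
    qed
  qed
  then have "(\<integral>\<^sup>+ z. ennreal (vol (Phat z) powr q) \<partial>sample_law \<mu> n C)
      \<le> (\<integral>\<^sup>+ z. ennreal (t powr q) + (\<Sum>P\<in>F. g P z) \<partial>sample_law \<mu> n C)"
    by (rule nn_integral_mono)
  also have "\<dots> = ennreal (t powr q) + (\<Sum>P\<in>F. \<integral>\<^sup>+ z. g P z \<partial>sample_law \<mu> n C)"
    using g_meas grid_polytopesD(4)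
    by (subst nn_integral_add; (subst nn_integral_sum)?) (auto simp: F_def S.emeasure_space_1 intro!: borel_measurable_sum)
  also have "\<dots> \<le> ennreal (t powr q) + (\<Sum>P\<in>F. ennreal (exp (n * (b * vol Q - a * t))))"
    by (intro add_left_mono sum_mono bound)
  also have "\<dots> = ennreal (t powr q + real (card F) * exp (n * (b * vol Q - a * t)))"
    by (simp add: ennreal_plus ennreal_mult ennreal_of_nat_eq_real_of_nat)
  also have "\<dots> \<le> ennreal (t powr q + real (card ?G) * exp (n * (b * vol Q - a * t)))"
    using card_mono[OF finG, of F] by (intro ennreal_leI add_left_mono mult_right_mono) (auto simp: F_def)
  finally show ?thesis unfolding vol_def a_def b_def .
qed

end

section \<open>Balancing approximation and entropy\<close>

lemma grid_polytopeI:
  fixes X :: "(real ^ 'd) set"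
  assumes "finite X" "X \<subseteq> cbox 0 One" "card X \<le> r" "interior (convex hull X) \<noteq> {}"
    and grid: "\<forall>x\<in>X. \<forall>b\<in>Basis. \<exists>k::int. x \<bullet> b = of_int k / of_nat n"
  shows "convex hull X \<in> grid_polytopes n r"
proof -
  have ext: "{v. v extreme_point_of (convex hull X)} \<subseteq> X"
    using extreme_point_of_convex_hull by blast
  then have "card {v. v extreme_point_of (convex hull X)} \<le> r"
    using card_mono[OF assms(1) ext] assms(3) by simp
  moreover have "\<exists>k::int. v $ i = of_int k / of_nat n" if "v extreme_point_of (convex hull X)" for v i
  proof -
    have "v \<in> X" using ext that by blast
    moreover have "axis i 1 \<in> (Basis :: (real ^ 'd) set)" by simp
    ultimately show ?thesis using grid by (metis cart_eq_inner_axis)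
  qed
  moreover have "convex hull X \<subseteq> unit_cube"
    unfolding unit_cube_eq_cbox using assms(2) by (intro hull_minimal) auto
  moreover have "polytope (convex hull X)" using assms(1) by (rule polytope_convex_hull)
  ultimately show ?thesis
    unfolding grid_polytopes_def using assms(4) by blast
qed

text \<open>The rate \<open>\<rho>\<close> is balanced so that the approximation error and the entropy
  \<open>r ln n\<close> per observation are both at most a multiple of \<open>\<rho>\<close>.\<close>
lemma rate_facts:
  fixes n r d :: nat and \<rho> s :: real
  assumes d: "d \<ge> 2" and n: "n \<ge> 2" and r1: "r \<ge> 1"
    and r: "r = nat \<lfloor>(real n / ln (real n)) powr ((real d - 1) / (real d + 1))\<rfloor>"
  defines "\<rho> \<equiv> (ln (real n) / real n) powr (2 / (real d + 1))"
    and "s \<equiv> (real n / ln (real n)) powr (1 / (real d + 1))"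
  shows "s \<ge> 1" "\<rho> = 1 / s\<^sup>2" "r = nat \<lfloor>s ^ (d - 1)\<rfloor>" "1 / n \<le> 2 * \<rho>"
    "r * ln n \<le> n * \<rho>" "ln n \<le> n * \<rho>" "ln (1 / \<rho>) \<le> 2 * ln n"
proof -
  define w where "w = real n / ln (real n)"
  \<comment> \<open>For \<open>n = 2\<close> the logarithm is below 1; the lower bound 1/2 is the
    source of the factor 2 in \<open>1 / n \<le> 2 * \<rho>\<close>.\<close>
  have "ln (2::real) \<le> ln n" using n by simp
  then have ln: "ln (real n) \<ge> 1 / 2" using ln2_ge_two_thirds by simp
  have w0: "w > 0" using n ln by (simp add: w_def)
  have s0: "s > 0" using w0 by (simp add: s_def w_def[symmetric])
  have sd: "s ^ (d - 1) = w powr ((real d - 1) / (real d + 1))"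
    using d w0 by (simp add: s_def w_def[symmetric] powr_powr of_nat_diff flip: powr_realpow)
  then show rs: "r = nat \<lfloor>s ^ (d - 1)\<rfloor>" unfolding r w_def by simp
  have rle: "real r \<le> s ^ (d - 1)" using r1 unfolding rs by linarith
  then have "1 \<le> s ^ (d - 1)" using r1 by linarith
  then show s1: "s \<ge> 1"
    using d s0 power_less_one_iff[of s "d - 1"] by (simp add: not_less[symmetric])
  have inv: "ln (real n) / real n = 1 / w" by (simp add: w_def)
  show rho: "\<rho> = 1 / s\<^sup>2"
    unfolding \<rho>_def inv s_def w_def[symmetric] using w0
    by (simp add: powr_divide powr_powr flip: powr_realpow)
  have ws: "w = s ^ (d + 1)"
  proof -
    have "s ^ (d + 1) = s powr (real d + 1)" using powr_realpow[OF s0, of "d + 1"] by (simp add: add.commute)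
    also have "\<dots> = w powr (1 / (real d + 1) * (real d + 1))"
      unfolding s_def w_def[symmetric] powr_powr ..
    also have "\<dots> = w" using w0 by (simp add: add_nonneg_eq_0_iff)
    finally show ?thesis ..
  qed
  have nw: "n = w * ln n" using ln by (simp add: w_def)
  have s2: "s\<^sup>2 \<le> w" unfolding ws using s1 d by (intro power_increasing) auto
  \<comment> \<open>Here the balance becomes visible: \<open>r\<close> is the integer part of
    \<open>s ^ (d - 1)\<close>, so the entropy \<open>r * ln n\<close> is at most
    \<open>n * \<rho>\<close>.\<close>
  have n\<rho>: "n * \<rho> = s ^ (d - 1) * ln n"
  proof -
    have "w = s ^ (d - 1) * s\<^sup>2" unfolding ws power_add[symmetric] using d by simp
    then show ?thesis unfolding rho using s0 by (subst nw) simp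
  qed
  show "r * ln n \<le> n * \<rho>" unfolding n\<rho> using rle ln by (intro mult_right_mono) auto
  moreover have "1 * ln n \<le> r * ln n" using r1 ln by (intro mult_right_mono) auto
  ultimately show "ln n \<le> n * \<rho>" by linarith
  have "s\<^sup>2 \<le> 2 * n"
  proof -
    have "w * (1 / 2) \<le> w * ln n" using w0 ln by (intro mult_left_mono) auto
    then show ?thesis using s2 nw by linarith
  qed
  then show "1 / n \<le> 2 * \<rho>" unfolding rho using s0 n by (simp add: field_simps)
  have "ln (1 / \<rho>) = ln (s\<^sup>2)" by (simp add: rho)
  also have "\<dots> \<le> ln (real n ^ 2)"
  proof -
    have "2 * real n \<le> real n ^ 2" using n by (simp add: power2_eq_square)
    from order_trans[OF \<open>s\<^sup>2 \<le> 2 * n\<close>[unfolded of_nat_mult of_nat_numeral] this]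
    show ?thesis by (rule ln_mono) (use s0 in simp)
  qed
  also have "\<dots> = 2 * ln n" using n by (simp add: ln_realpow)
  finally show "ln (1 / \<rho>) \<le> 2 * ln n" .
qed

text \<open>From \<open>2 * m + 1 \<le> 3 * m\<close> the left side is at most
  \<open>3 * d * (3 * m) ^ (d - 1)\<close>. Since \<open>d - 1 \<ge> 1\<close>, the factor
  \<open>3 * d\<close> can be moved into the power, which gives the constant 9.\<close>

lemma net_size_le:
  fixes d m :: nat and s :: real
  assumes d: "d \<ge> 2" and m: "m \<ge> 1" and s: "9 * d * m \<le> s"
  shows "2 * d * (2 * m + 1) ^ (d - 1) + d \<le> nat \<lfloor>s ^ (d - 1)\<rfloor>"
proof -
  have "2 * d * (2 * m + 1) ^ (d - 1) \<le> 2 * d * (3 * m) ^ (d - 1)"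
    using m by (intro mult_le_mono2 power_mono) auto
  moreover have "d * 1 \<le> d * (3 * m) ^ (d - 1)"
    using m by (intro mult_le_mono2 one_le_power) auto
  moreover have "3 * d \<le> (3 * d) ^ (d - 1)" using d by (intro self_le_power) auto
  then have "3 * d * (3 * m) ^ (d - 1) \<le> (3 * d) ^ (d - 1) * (3 * m) ^ (d - 1)"
    by (rule mult_le_mono1)
  moreover have "(3 * d) ^ (d - 1) * (3 * m) ^ (d - 1) = (9 * d * m) ^ (d - 1)"
    unfolding power_mult_distrib[symmetric] by (simp add: mult_ac)
  ultimately have "2 * d * (2 * m + 1) ^ (d - 1) + d \<le> (9 * d * m) ^ (d - 1)" by linarith
  then have "real (2 * d * (2 * m + 1) ^ (d - 1) + d) \<le> real ((9 * d * m) ^ (d - 1))"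
    using of_nat_le_iff by blast
  also have "\<dots> \<le> s ^ (d - 1)" using s by (simp add: power_mono del: of_nat_mult)
  finally show ?thesis by (simp add: le_nat_floor)
qed

text \<open>For large \<open>s\<close> the vertex budget \<open>r\<close> pays for a net with
  \<open>m\<close> proportional to \<open>s\<close>, and both error terms are of order
  \<open>1 / s^2\<close>. For bounded \<open>s\<close> any grid polytope will do, because volumes
  are at most 1.\<close>

lemma grid_polytope_approximation:
  assumes d: "CARD('d::finite) \<ge> 2"
  shows "\<exists>B>0. \<forall>(C::(real ^ 'd) set) n r s. C \<in> convex_bodies \<longrightarrow> n \<ge> 1 \<longrightarrow> s \<ge> (1::real) \<longrightarrow>
    1 / real n \<le> 2 / s\<^sup>2 \<longrightarrow> r = nat \<lfloor>s ^ (CARD('d) - 1)\<rfloor> \<longrightarrow> grid_polytopes n r \<noteq> ({} :: (real ^ 'd) set set) \<longrightarrow>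
    (\<exists>Q \<in> grid_polytopes n r. measure lborel (sym_diff Q C) \<le> B / s\<^sup>2)"
proof -
  define d where "d = CARD('d)"
  obtain K where K: "K > 0" and approx: "\<And>(C::(real ^ 'd) set) n m. \<lbrakk>convex C; compact C; C \<noteq> {}; C \<subseteq> cbox 0 One; n \<ge> 1; m \<ge> 1\<rbrakk> \<Longrightarrow>
    (\<exists>X. finite X \<and> X \<subseteq> cbox 0 One \<and> (\<forall>x\<in>X. \<forall>b\<in>Basis. \<exists>k::int. x \<bullet> b = of_int k / of_nat n) \<and>
      card X \<le> 2 * d * (2 * m + 1) ^ (d - 1) + d \<and>
      interior (convex hull X) \<noteq> {} \<and>
      measure lborel (sym_diff (convex hull X) C) \<le> K * (1 / (real m)\<^sup>2 + 1 / real n))"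
    using grid_hull_approximation[where 'a="real ^ 'd"] unfolding d_def by (auto simp: mult_ac)
  \<comment> \<open>324 is the square of 18, from \<open>s \<le> 18 * d * m\<close>; the 2 comes
    from the bound on \<open>1 / n\<close>; 81 is the square of 9, for the case
    \<open>s < 9 * d\<close>.\<close>
  define B where "B = K * (324 * (real d)\<^sup>2 + 2) + 81 * (real d)\<^sup>2"
  have B1: "K * (324 * (real d)\<^sup>2 + 2) \<le> B" "81 * (real d)\<^sup>2 \<le> B"
    using K by (auto simp: B_def)
  have "\<exists>Q \<in> grid_polytopes n r. measure lborel (sym_diff Q C) \<le> B / s\<^sup>2"
    if C: "C \<in> convex_bodies" and n: "n \<ge> 1" and s: "s \<ge> 1" "1 / real n \<le> 2 / s\<^sup>2"
      and r: "r = nat \<lfloor>s ^ (d - 1)\<rfloor>" and ne: "grid_polytopes n r \<noteq> ({} :: (real ^ 'd) set set)"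
    for C :: "(real ^ 'd) set" and n r s
  proof (cases "s \<ge> 9 * d")
    case True
    \<comment> \<open>The finest net that \<open>net_size_le\<close> admits; taking the integer part
      costs at most a factor 2.\<close>
    define m where "m = nat \<lfloor>s / (9 * d)\<rfloor>"
    have d0: "real d > 0" using d by (simp add: d_def)
    have sd: "1 \<le> s / (9 * d)" using True d0 by simp
    then have m: "m \<ge> 1" "real m \<le> s / (9 * d)" "s / (9 * d) \<le> 2 * real m"
    proof -
      have "real m = of_int \<lfloor>s / (9 * d)\<rfloor>" unfolding m_def using sd by (intro of_nat_nat) linarith
      moreover have "1 \<le> real_of_int \<lfloor>s / (9 * d)\<rfloor>" using sd by (simp add: le_floor_iff)
      ultimately show "m \<ge> 1" "real m \<le> s / (9 * d)" "s / (9 * d) \<le> 2 * real m" using sd by linarith+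
    qed
    have "9 * d * m \<le> s" using m(2) d0 by (simp add: field_simps)
    then have size: "2 * d * (2 * m + 1) ^ (d - 1) + d \<le> r"
      unfolding r using d m by (intro net_size_le) (auto simp: d_def)
    have C': "convex C" "compact C" "C \<noteq> {}" "C \<subseteq> cbox 0 One"
      using C by (auto simp: convex_bodies_def unit_cube_eq_cbox)
    obtain X where X: "finite X" "X \<subseteq> cbox 0 One" "\<forall>x\<in>X. \<forall>b\<in>Basis. \<exists>k::int. x \<bullet> b = of_int k / of_nat n"
      "card X \<le> 2 * d * (2 * m + 1) ^ (d - 1) + d" "interior (convex hull X) \<noteq> {}"
      "measure lborel (sym_diff (convex hull X) C) \<le> K * (1 / (real m)\<^sup>2 + 1 / real n)"
      using approx[OF C' n m(1)] by blast
    have "1 / (real m)\<^sup>2 \<le> 324 * (real d)\<^sup>2 / s\<^sup>2"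
    proof -
      have "s \<le> 18 * real d * real m" using m(3) d0 by (simp add: field_simps)
      then have "s\<^sup>2 \<le> (18 * real d * real m)\<^sup>2" using s(1) by (intro power_mono) auto
      then show ?thesis using m(1) s(1) by (simp add: field_simps power_mult_distrib)
    qed
    then have "K * (1 / (real m)\<^sup>2 + 1 / real n) \<le> K * (324 * (real d)\<^sup>2 / s\<^sup>2 + 2 / s\<^sup>2)"
      using K s(2) by (intro mult_left_mono add_mono) auto
    also have "\<dots> = K * (324 * (real d)\<^sup>2 + 2) / s\<^sup>2"
      by (simp only: add_divide_distrib[symmetric] times_divide_eq_right)
    also have "\<dots> \<le> B / s\<^sup>2" using B1 by (intro divide_right_mono) auto
    finally have "measure lborel (sym_diff (convex hull X) C) \<le> B / s\<^sup>2" using X(6) by linarith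
    moreover have "convex hull X \<in> grid_polytopes n r"
      using X size by (intro grid_polytopeI) auto
    ultimately show ?thesis by blast
  next
    case False
    obtain Q :: "(real ^ 'd) set" where Q: "Q \<in> grid_polytopes n r" using ne by blast
    have "measure lborel (sym_diff Q C) \<le> 1"
      using grid_polytopesD(3)[OF Q] C by (intro measure_le_1_of_subset_unit_cube) (auto simp: convex_bodies_def)
    also have "1 \<le> B / s\<^sup>2"
    proof -
      have "s\<^sup>2 \<le> (9 * real d)\<^sup>2" using False s(1) by (intro power_mono) auto
      then have "s\<^sup>2 \<le> B" using B1(2) by (simp add: power_mult_distrib)
      then show ?thesis using s(1) by simp
    qed
    finally show ?thesis using Q by blast
  qed
  moreover have "B > 0" using K unfolding B_def by (intro add_pos_nonneg mult_pos_pos add_nonneg_pos) auto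
  ultimately show ?thesis unfolding d_def by blast
qed

theorem corollary2:
  fixes \<sigma> q :: real
  assumes "CARD('d::finite) \<ge> 2" and "\<sigma> > 0" and "q > 0"
  shows "\<exists>A::real. A > 0 \<and>
    (\<forall>(n::nat) (r::nat) (\<mu>::real measure) (Phat::(nat \<Rightarrow> (real ^ 'd) \<times> real) \<Rightarrow> (real ^ 'd) set).
       n \<ge> 2 \<longrightarrow>
       r = nat \<lfloor>(real n / ln (real n)) powr ((real CARD('d) - 1) / (real CARD('d) + 1))\<rfloor> \<longrightarrow>
       r \<ge> CARD('d) + 1 \<longrightarrow>
       prob_space \<mu> \<longrightarrow> sets \<mu> = sets borel \<longrightarrow> subgaussian \<sigma> \<mu> \<longrightarrow>
       polytope_estimator n r Phat \<longrightarrow>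
       (SUP C \<in> convex_bodies.
          \<integral>\<^sup>+ z. ennreal (measure lborel (sym_diff (Phat z) C) powr q) \<partial>(sample_law \<mu> n C))
       \<le> ennreal (A * (ln (real n) / real n) powr (2 * q / (real CARD('d) + 1))))"
proof -
  define d where "d = CARD('d)"
  obtain B where B: "B > 0" and approx: "\<And>(C::(real ^ 'd) set) n r s. \<lbrakk>C \<in> convex_bodies; n \<ge> 1; s \<ge> (1::real);
    1 / real n \<le> 2 / s\<^sup>2; r = nat \<lfloor>s ^ (d - 1)\<rfloor>; grid_polytopes n r \<noteq> ({} :: (real ^ 'd) set set)\<rbrakk> \<Longrightarrow>
    \<exists>Q \<in> grid_polytopes n r. measure lborel (sym_diff Q C) \<le> B / s\<^sup>2"
    using grid_polytope_approximation[OF assms(1)] unfolding d_def by blast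
  define \<kappa> where "\<kappa> = 1 / (8 * \<sigma>\<^sup>2)"
  define a where "a = 1 - exp (- \<kappa>)"
  define b where "b = exp (3 * \<kappa>) - exp (- \<kappa>)"
  have "\<kappa> > 0" using assms(2) by (simp add: \<kappa>_def)
  then have a: "a > 0" and b: "b > 0" by (auto simp: a_def b_def)
  \<comment> \<open>Chosen so that \<open>2 * d + b * B - a * T = - 2 * q\<close>: the threshold
    \<open>T * \<rho>\<close> beats the entropy and the approximation error and leaves a surplus for
    the tail.\<close>
  define T where "T = (2 * q + 2 * d + b * B) / a"
  have T: "T > 0" unfolding T_def using a b B assms(3) by (intro divide_pos_pos add_pos_pos add_pos_nonneg) auto
  \<comment> \<open>The first summand covers losses below the threshold, the 1 covers the
    tail.\<close>
  define A where "A = T powr q + 1"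
  have "(\<integral>\<^sup>+ z. ennreal (measure lborel (sym_diff (Phat z) C) powr q) \<partial>(sample_law \<mu> n C))
       \<le> ennreal (A * (ln (real n) / real n) powr (2 * q / (real CARD('d) + 1)))"
    if n: "n \<ge> 2" and r: "r = nat \<lfloor>(real n / ln (real n)) powr ((real d - 1) / (real d + 1))\<rfloor>"
      and rd: "r \<ge> d + 1" and mu: "prob_space \<mu>" "sets \<mu> = sets borel" "subgaussian \<sigma> \<mu>"
      and est: "polytope_estimator n r Phat" and C: "C \<in> convex_bodies"
    for n r :: nat and \<mu> :: "real measure" and Phat :: "(nat \<Rightarrow> (real ^ 'd) \<times> real) \<Rightarrow> (real ^ 'd) set"
      and C :: "(real ^ 'd) set"
  proof -
    define \<rho> where "\<rho> = (ln (real n) / real n) powr (2 / (real d + 1))"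
    define s where "s = (real n / ln (real n)) powr (1 / (real d + 1))"
    have d2: "d \<ge> 2" and r1: "r \<ge> 1" using assms(1) rd by (auto simp: d_def)
    note rate = rate_facts[OF d2 n r1 r, folded \<rho>_def s_def]
    have \<rho>: "\<rho> > 0" using rate(1,2) by simp
    have Ccube: "C \<subseteq> unit_cube" "C \<in> sets borel"
      using C by (auto simp: convex_bodies_def intro!: borel_closed compact_imp_closed)
    \<comment> \<open>The class is nonempty because the estimator takes values in it; any sample can
      serve, here the zero one.\<close>
    have "Phat (\<lambda>i\<in>{1..n}. 0) \<in> grid_polytopes n r"
      using est unfolding polytope_estimator_def by (auto simp: space_PiM is_arg_min_def)
    then obtain Q where Q: "Q \<in> grid_polytopes n r" "measure lborel (sym_diff Q C) \<le> B * \<rho>"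
      using approx[OF C _ rate(1) _ rate(3), of n] n rate(4) by (auto simp: rate(2))
    have "real (card (grid_polytopes n r :: (real ^ 'd) set set)) \<le> real (((n + 1) ^ d) ^ r)"
      using finite_grid_polytopes(2)[of n r, where 'd='d] n unfolding d_def of_nat_le_iff by simp
    also have "\<dots> \<le> real (((n ^ 2) ^ d) ^ r)"
    proof -
      \<comment> \<open>Replacing \<open>n + 1\<close> by the square of \<open>n\<close> turns the
        log-cardinality into \<open>2 * d * r * ln n\<close>.\<close>
      have "n + 1 \<le> n * n" using n mult_le_mono1[of 2 n n] by linarith
      then have "((n + 1) ^ d) ^ r \<le> ((n ^ 2) ^ d) ^ r"
        unfolding power2_eq_square by (intro power_mono) auto
      then show ?thesis using of_nat_le_iff by blast
    qed
    also have "\<dots> = exp (2 * d * (r * ln n))"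
    proof -
      have "real (((n ^ 2) ^ d) ^ r) = exp (ln n) ^ (2 * d * r)" using n by (simp flip: power_mult)
      then show ?thesis by (simp add: mult_ac flip: exp_of_nat_mult)
    qed
    also have "\<dots> \<le> exp (2 * d * (n * \<rho>))"
      using rate(5) by (simp add: mult_left_mono)
    finally have card: "real (card (grid_polytopes n r :: (real ^ 'd) set set)) \<le> exp (2 * d * (n * \<rho>))" .
    have "real (card (grid_polytopes n r :: (real ^ 'd) set set)) *
        exp (n * (b * measure lborel (sym_diff Q C) - a * (T * \<rho>)))
      \<le> exp (2 * d * (n * \<rho>)) * exp (n * (b * (B * \<rho>) - a * (T * \<rho>)))"
      using card Q(2) b by (intro mult_mono) (auto intro!: mult_left_mono)
    also have "\<dots> = exp (n * \<rho> * (2 * d + b * B - a * T))"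
      by (simp add: algebra_simps flip: exp_add)
    also have "2 * d + b * B - a * T = - 2 * q" using a by (simp add: T_def)
    also have "exp (n * \<rho> * (- 2 * q)) \<le> \<rho> powr q"
    proof -
      \<comment> \<open>Both sides are compared with \<open>2 * ln n\<close>; the surplus exponent
        \<open>- 2 * q\<close> thus brings the tail below \<open>\<rho> powr q\<close>.\<close>
      have "- ln \<rho> \<le> 2 * (n * \<rho>)"
        using rate(6,7) \<rho> by (simp add: ln_div)
      then have "q * (- ln \<rho>) \<le> q * (2 * (n * \<rho>))" using assms(3) by (intro mult_left_mono) auto
      then show ?thesis using \<rho> by (simp add: powr_def mult_ac)
    qed
    finally have tail: "real (card (grid_polytopes n r :: (real ^ 'd) set set)) *
        exp (n * (b * measure lborel (sym_diff Q C) - a * (T * \<rho>))) \<le> \<rho> powr q" .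
    have "(\<integral>\<^sup>+ z. ennreal (measure lborel (sym_diff (Phat z) C) powr q) \<partial>(sample_law \<mu> n C))
      \<le> ennreal ((T * \<rho>) powr q + real (card (grid_polytopes n r :: (real ^ 'd) set set)) *
          exp (n * (b * measure lborel (sym_diff Q C) - a * (T * \<rho>))))"
      unfolding a_def b_def \<kappa>_def using n T \<rho> assms
      by (intro risk_bound[OF mu(1,2) Ccube(2) mu(3) _ Ccube(1) est Q(1)]) auto
    also have "\<dots> \<le> ennreal (A * \<rho> powr q)"
      using tail T \<rho> by (intro ennreal_leI) (simp add: A_def powr_mult algebra_simps)
    also have "\<rho> powr q = (ln (real n) / real n) powr (2 * q / (real CARD('d) + 1))"
      unfolding \<rho>_def d_def powr_powr by simp
    finally show ?thesis .
  qed
  moreover have "A > 0" unfolding A_def by (simp add: add_nonneg_pos)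
  ultimately show ?thesis unfolding d_def by (intro exI[of _ A]) (auto intro!: SUP_least)
qed

end
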